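(* Let $M=(E,G)$ be a claw-free matroid and let $H$ be a hyperplane of $G$ such that $M|H$ has a decomposer. Then at least one of the following holds: $M$ is even-plane; $M$ is a PG-sum; $M^c$ is triangle-free; or $M$ has a decomposer.
   Context: A matroid is a pair $M=(E,G)$ where $G$ is the set of nonzero vectors of a finite-dimensional $\mathbb F_2$-vector space $V(G)=G\cup\{0\}$ and $E\subseteq G$. A flat of $G$ is a set $F\subseteq G$ with $F\cup\{0\}$ a subspace; triangles, planes and hyperplanes are flats of dimension $2$, $3$ and $\dim(G)-1$. $M|F=(E\cap F,F)$. A claw is $(B,G)$ with $\dim G=3$, $B$ a basis; $M$ is claw-free if no $M|F$ is isomorphic (via a linear isomorphism) to a claw. $M$ is even-plane if $|E\cap P|$ is even for every plane $P$. $M$ is a PG-sum if $E$ is the disjoint union of two (possibly empty) flats. $M^c=(G\setminus E,G)$; triangle-free means the ground set contains no triangle. For a flat $F$ of an ambient geometry $G'$ of a matroid $(E',G')$, a coset of $F$ is $x+(F\cup\{0\})$ with $x\in G'\setminus F$; it is mixed if it meets both $E'$ and $G'\setminus E'$; a decomposer of $(E',G')$ is a nonempty flat $F\ne G'$ of $G'$ with no mixed cosets. *)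

theory Defs
  imports Complex_Main "HOL-Library.Z2"
begin

text \<open>A matroid is a pair (E, G), where \<open>insert 0 G\<close> is a finite-dimensional subspace of some
  ambient vector space over the two-element field \<open>bit\<close>. The ambient space is the whole type and may
  be larger than \<open>insert 0 G\<close>, so that a restriction of a matroid is again a matroid in the same sense.\<close>

type_synonym 'a matroid = "'a set \<times> 'a set"

definition restr :: "'a matroid \<Rightarrow> 'a set \<Rightarrow> 'a matroid" where
  "restr M F = (fst M \<inter> F, F)"

definition compl :: "'a matroid \<Rightarrow> 'a matroid" where
  "compl M = (snd M - fst M, snd M)"

locale binary_space = vector_space scale
  for scale :: "bit \<Rightarrow> 'a::ab_group_add \<Rightarrow> 'a"
begin

definition is_matroid :: "'a matroid \<Rightarrow> bool" where
  "is_matroid M \<longleftrightarrow>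
     0 \<notin> snd M \<and> subspace (insert 0 (snd M)) \<and> (\<exists>B. finite B \<and> span B = insert 0 (snd M)) \<and>
     fst M \<subseteq> snd M"

definition flat :: "'a set \<Rightarrow> 'a set \<Rightarrow> bool" where
  "flat G F \<longleftrightarrow> F \<subseteq> G \<and> subspace (insert 0 F)"

definition triangle :: "'a set \<Rightarrow> 'a set \<Rightarrow> bool" where
  "triangle G T \<longleftrightarrow> flat G T \<and> dim (insert 0 T) = 2"

definition plane :: "'a set \<Rightarrow> 'a set \<Rightarrow> bool" where
  "plane G P \<longleftrightarrow> flat G P \<and> dim (insert 0 P) = 3"

text \<open>Not stated with \<open>-\<close>, because truncated subtraction would make the empty flat a hyperplane of
  the empty geometry.\<close>

definition hyperplane :: "'a set \<Rightarrow> 'a set \<Rightarrow> bool" where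
  "hyperplane G H \<longleftrightarrow> flat G H \<and> dim (insert 0 H) + 1 = dim (insert 0 G)"

definition isomorphic :: "'a matroid \<Rightarrow> 'a matroid \<Rightarrow> bool" where
  "isomorphic M N \<longleftrightarrow>
     (\<exists>f. bij_betw f (insert 0 (snd M)) (insert 0 (snd N)) \<and>
          (\<forall>x\<in>insert 0 (snd M). \<forall>y\<in>insert 0 (snd M). f (x + y) = f x + f y) \<and>
          (\<forall>c. \<forall>x\<in>insert 0 (snd M). f (scale c x) = scale c (f x)) \<and>
          f ` fst M = fst N)"

definition claw :: "'a matroid \<Rightarrow> bool" where
  "claw N \<longleftrightarrow>
     is_matroid N \<and> dim (insert 0 (snd N)) = 3 \<and>
     independent (fst N) \<and> span (fst N) = insert 0 (snd N)"

text \<open>It is enough to let \<open>N\<close> range over the claws in the given ambient space: a restriction of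
  \<open>M\<close> isomorphic to a claw in any other space is itself a claw.\<close>

definition claw_free :: "'a matroid \<Rightarrow> bool" where
  "claw_free M \<longleftrightarrow> \<not> (\<exists>F N. flat (snd M) F \<and> claw N \<and> isomorphic (restr M F) N)"

definition even_plane :: "'a matroid \<Rightarrow> bool" where
  "even_plane M \<longleftrightarrow> (\<forall>P. plane (snd M) P \<longrightarrow> even (card (fst M \<inter> P)))"

definition PG_sum :: "'a matroid \<Rightarrow> bool" where
  "PG_sum M \<longleftrightarrow>
     (\<exists>F1 F2. flat (snd M) F1 \<and> flat (snd M) F2 \<and> F1 \<inter> F2 = {} \<and> fst M = F1 \<union> F2)"

definition triangle_free :: "'a matroid \<Rightarrow> bool" where
  "triangle_free M \<longleftrightarrow> \<not> (\<exists>T. triangle (snd M) T \<and> T \<subseteq> fst M)"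

definition coset :: "'a set \<Rightarrow> 'a set \<Rightarrow> 'a set \<Rightarrow> bool" where
  "coset G F A \<longleftrightarrow> (\<exists>x\<in>G - F. A = (+) x ` insert 0 F)"

definition mixed :: "'a matroid \<Rightarrow> 'a set \<Rightarrow> bool" where
  "mixed M A \<longleftrightarrow> A \<inter> fst M \<noteq> {} \<and> A \<inter> (snd M - fst M) \<noteq> {}"

definition decomposer :: "'a matroid \<Rightarrow> 'a set \<Rightarrow> bool" where
  "decomposer M F \<longleftrightarrow>
     flat (snd M) F \<and> F \<noteq> {} \<and> F \<noteq> snd M \<and> \<not> (\<exists>A. coset (snd M) F A \<and> mixed M A)"

end

end

(*
Let F be a decomposer of M|H and suppose that M has none. A claw in the plane spanned by x, y
outside H and u in F relates, for any two cosets x + F and y + F, the pairs {x, x + u} and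
{y, y + u}. If every u in F - E stabilizes E on every coset of F outside H, or if a mixed coset
forces its neighbours to be full or to be empty, then E is determined up to subspaces: any
remaining freedom yields a subspace none of whose cosets is mixed, so M is a PG-sum or M^c is
triangle-free. Otherwise some point w outside E satisfies (E + w) and E agree on H, that is, {w} is a
decomposer of M|H. Let m be the set of x outside H for which exactly one of x, x + w is in E. The
span of m is everything, every point outside H and m is in E, and m is invariant under
Z = H - E. Parity identities on the squares x, x + z, x + c, x + z + c (with z in Z) then show that
M is even-plane or that Z is a subspace on which translation acts on m either by fixing or by
flipping membership in E. In the latter case, if Z is more than {0, w}, some z or z + w is itself a
decomposer of M; if Z = {0, w}, then M^c is triangle-free.
*)
theory Submission
  imports Defs
begin

text \<open>Absence of a decomposer serves as an existence principle. The stabilizer of a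
  well-chosen set is a subspace; if it also absorbs whatever could make one of its cosets mixed, it
  must be \<open>{0}\<close> or all of \<open>V\<close>. The work lies in finding sets for which
  both outcomes are absurd.

  Two points \<open>x + v\<close> and \<open>x + v + u\<close> have sum \<open>u\<close>, so both
  can be among the three elements of a claw only if \<open>u \<notin> E\<close>. This is why the
  cases turn on the elements of \<open>F - E\<close>; an element of \<open>F \<inter> E\<close>
  gives the weaker information that it stabilizes one of two cosets joined by the complement of
  \<open>E\<close>.

  Claw-freeness forbids single membership patterns and is not symmetric under complementation.
  Passing from \<open>F\<close> to one point \<open>w\<close> restores a symmetry: translation by
  \<open>w\<close> preserves membership on \<open>H\<close> and negates it on the moved points. Each
  forbidden pattern then has a forbidden negated partner, and these one-sided exclusions add up to
  parity identities.\<close>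

context binary_space
begin

section \<open>Addition in characteristic two\<close>

lemma add_self [simp]: "x + x = (0::'a)"
proof -
  have "x + x = scale (1 + 1) x"
    by (simp only: scale_left_distrib scale_one)
  then show ?thesis by simp
qed

lemma add_self_left [simp]: "x + (x + y) = (y::'a)"
  by (simp flip: add.assoc)

lemma add_eq_0 [simp]: "x + y = 0 \<longleftrightarrow> x = (y::'a)"
  by (metis add.right_neutral add_self add_self_left)

lemmas char2 = add.assoc add.commute add.left_commute

lemma add_eq_swap: "x + y = z \<longleftrightarrow> x = y + (z::'a)"
  by (metis add.commute add_self_left)

lemma subspace_iff: "subspace S \<longleftrightarrow> 0 \<in> S \<and> (\<forall>x\<in>S. \<forall>y\<in>S. x + y \<in> S)"
proof -
  have "scale c x \<in> S" if "0 \<in> S" "x \<in> S" for c x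
    using that by (cases c) auto
  then show ?thesis
    unfolding subspace_def by blast
qed

lemma subspace_addL: "subspace S \<Longrightarrow> x \<in> S \<Longrightarrow> x + y \<in> S \<longleftrightarrow> y \<in> S"
  by (metis add_self_left subspace_add)

lemma subspace_addR: "subspace S \<Longrightarrow> y \<in> S \<Longrightarrow> x + y \<in> S \<longleftrightarrow> x \<in> S"
  by (metis add.commute subspace_addL)

lemma subspace_Un_coset:
  assumes "subspace S"
  shows "subspace {y. y \<in> S \<or> y + x \<in> S}"
  unfolding subspace_iff
proof (intro conjI ballI)
  fix a b assume "a \<in> {y. y \<in> S \<or> y + x \<in> S}" "b \<in> {y. y \<in> S \<or> y + x \<in> S}"
  moreover have "(a + x) + (b + x) = a + b" "(a + x) + b = a + b + x" "a + (b + x) = a + b + x"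
    by (simp_all add: char2)
  ultimately show "a + b \<in> {y. y \<in> S \<or> y + x \<in> S}"
    using subspace_add[OF assms] by (metis (mono_tags, lifting) mem_Collect_eq)
qed (use subspace_0[OF assms] in simp)

end

section \<open>Claws as membership patterns\<close>

locale claw_free_matroid = binary_space scale
  for scale :: "bit \<Rightarrow> 'a::ab_group_add \<Rightarrow> 'a" +
  fixes V E :: "'a set"
  assumes subspace_V: "subspace V"
    and E_subset: "E \<subseteq> V"
    and zero_notin_E [simp]: "0 \<notin> E"
    and claw: "\<lbrakk>x \<in> E; y \<in> E; z \<in> E; x \<noteq> y; x \<noteq> z; y \<noteq> z;
      x + y \<notin> E; x + z \<notin> E; y + z \<notin> E\<rbrakk> \<Longrightarrow> x + y + z \<in> E"
begin

text \<open>No distinctness or independence is required, since degenerate triples contradict the other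
  hypotheses.\<close>

lemma no_claw:
  assumes "p \<in> E" "q \<in> E" "r \<in> E" "p + q \<notin> E" "p + r \<notin> E" "q + r \<notin> E" "p + q + r \<notin> E"
  shows False
proof -
  have "p \<noteq> q" "p \<noteq> r" "q \<noteq> r"
    using assms by (auto simp: char2)
  then show False
    using claw assms by blast
qed

text \<open>In this and the next two patterns, if just one of the two compared points were in
  \<open>E\<close>, it would form a claw with two elements of \<open>E\<close> supplied by the
  hypotheses.\<close>

lemma claw_pattern1:
  assumes "m \<in> E" "a \<notin> E" "m + a \<in> E" "x \<notin> E" "x + a \<notin> E"
  shows "x + m \<in> E \<longleftrightarrow> x + m + a \<in> E"
  using no_claw[of m "m + a" "x + m"] no_claw[of m "m + a" "x + m + a"] assms
  by (auto simp: char2)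

lemma claw_pattern2:
  assumes "m \<notin> E" "a \<notin> E" "m + a \<in> E" "x + m \<in> E" "x + a \<notin> E"
  shows "x \<in> E \<longleftrightarrow> x + m + a \<in> E"
  using no_claw[of "m + a" "x + m" x] no_claw[of "m + a" "x + m" "x + m + a"] assms
  by (auto simp: char2)

lemma claw_pattern3:
  assumes "a \<in> E" "m \<notin> E" "m + a \<notin> E" "x \<notin> E" "x + a \<in> E"
  shows "x + m \<in> E \<longleftrightarrow> x + m + a \<in> E"
  using no_claw[of a "x + a" "x + m"] no_claw[of a "x + a" "x + m + a"] assms
  by (auto simp: char2)

text \<open>The parity of \<open>E\<close> on the seven nonzero combinations, as an iterated
  exclusive or. It also makes sense for dependent triples, so identities between planes need no side
  conditions.\<close>

definition plane_odd :: "'a \<Rightarrow> 'a \<Rightarrow> 'a \<Rightarrow> bool" where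
  "plane_odd p q r \<longleftrightarrow> ((((((p \<in> E) \<noteq> (q \<in> E)) \<noteq> (p + q \<in> E)) \<noteq> (r \<in> E)) \<noteq> (p + r \<in> E))
    \<noteq> (q + r \<in> E)) \<noteq> (p + q + r \<in> E)"

end

text \<open>Translation by \<open>d\<close> is its own inverse and preserves the complement of
  \<open>D\<close>, so the one-way implication already says that no coset of \<open>D\<close> is
  mixed.\<close>

locale indecomposable_matroid = claw_free_matroid +
  assumes invariant_subspace_trivial: "\<lbrakk>subspace D; D \<subseteq> V; D \<noteq> V;
    \<And>a d. \<lbrakk>a \<in> V; a \<notin> D; d \<in> D; a \<in> E\<rbrakk> \<Longrightarrow> a + d \<in> E\<rbrakk> \<Longrightarrow> D = {0}"
begin

text \<open>The union of the cosets of \<open>R\<close> lying entirely inside \<open>E\<close> (for \<open>b = True\<close>) or entirely outside \<open>E\<close> has a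
  stabilizer which, if it contains all mixed cosets, is a decomposer.\<close>

lemma uniform_cosets_empty:
  assumes R: "subspace R" "R \<subseteq> V" "R \<noteq> {0}"
    and mix: "\<And>m a r. \<lbrakk>m \<in> V; m \<notin> R; r \<in> R; (m + r \<in> E) \<noteq> (m \<in> E); a \<in> V; a \<notin> R;
      \<forall>r\<in>R. (a + r \<in> E) = b\<rbrakk> \<Longrightarrow> m + a \<notin> R \<and> (\<forall>r\<in>R. (m + a + r \<in> E) = b)"
    and a: "a \<in> V" "a \<notin> R" "\<forall>r\<in>R. (a + r \<in> E) = b"
  shows False
proof -
  define B where "B = {a \<in> V. a \<notin> R \<and> (\<forall>r\<in>R. (a + r \<in> E) = b)}"
  define Q where "Q = {q \<in> V. \<forall>a\<in>B. q + a \<in> B}"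
  have sQ: "subspace Q"
    unfolding subspace_iff Q_def using subspace_V
    by (auto simp: subspace_0 subspace_add add.assoc)
  have RQ: "R \<subseteq> Q"
  proof
    fix r assume r: "r \<in> R"
    have "r + a \<in> B" if "a \<in> B" for a
    proof -
      have "(r + a + r' \<in> E) = b" if "r' \<in> R" for r'
      proof -
        have "r + a + r' = a + (r + r')" by (simp add: char2)
        moreover have "r + r' \<in> R" using r that subspace_add[OF R(1)] by blast
        ultimately show ?thesis
          using \<open>a \<in> B\<close> unfolding B_def by (metis (mono_tags, lifting) mem_Collect_eq)
      qed
      then show ?thesis
        using that r R subspace_V unfolding B_def
        by (auto simp: subspace_addL subsetD)
    qed
    then show "r \<in> Q"
      unfolding Q_def using r R by auto
  qed
  have mQ: "m \<in> Q" if "m \<in> V" "m \<notin> R" "r \<in> R" "(m + r \<in> E) \<noteq> (m \<in> E)" for m r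
    using that mix[of m r] subspace_V unfolding Q_def B_def by (auto simp: subspace_add)
  have aB: "a \<in> B" using a unfolding B_def by simp
  have "Q \<noteq> V"
  proof
    assume "Q = V"
    then have "a + a \<in> B" using aB a unfolding Q_def by blast
    then show False unfolding B_def using subspace_0[OF R(1)] by simp
  qed
  \<comment> \<open>Outside \<open>Q\<close> every coset of \<open>R\<close> is uniform, and one
    with value \<open>b\<close> spreads along all of \<open>Q\<close>. Hence no coset of
    \<open>Q\<close> is mixed.\<close>
  moreover have "a' + d \<in> E" if a': "a' \<in> V" "a' \<notin> Q" "d \<in> Q" "a' \<in> E" for a' d
  proof (rule ccontr)
    assume n: "a' + d \<notin> E"
    have u1: "(a' + r \<in> E)" if "r \<in> R" for r
      using mQ[of a' r] a' RQ that by blast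
    have "d \<in> V" using a' unfolding Q_def by blast
    then have ad: "a' + d \<in> V" "a' + d \<notin> Q"
      using a' subspace_addR[OF sQ] subspace_add[OF subspace_V] by blast+
    then have u2: "(a' + d + r \<notin> E)" if "r \<in> R" for r
      using mQ[of "a' + d" r] RQ that n by blast
    show False
    proof (cases b)
      case True
      then have "a' \<in> B" using a' u1 RQ unfolding B_def by auto
      then have "d + a' \<in> B" using a' unfolding Q_def by blast
      then have "d + a' + 0 \<in> E" using True subspace_0[OF R(1)] unfolding B_def by blast
      then show False using n by (simp add: add.commute)
    next
      case False
      then have "a' + d \<in> B" using ad u2 RQ unfolding B_def by auto
      then have "d + (a' + d) \<in> B" using a' unfolding Q_def by blast
      then have "a' + 0 \<notin> E" using False subspace_0[OF R(1)] unfolding B_def by (auto simp: char2)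
      then show False using a' by simp
    qed
  qed
  ultimately have "Q = {0}"
    using invariant_subspace_trivial[OF sQ] unfolding Q_def by blast
  then show False
    using RQ R subspace_0[OF R(1)] by blast
qed

lemma subspace_containing_E:
  "\<lbrakk>subspace D; D \<subseteq> V; D \<noteq> V; E \<subseteq> D\<rbrakk> \<Longrightarrow> D = {0}"
  using invariant_subspace_trivial by blast

lemma subspace_containing_complement:
  assumes "subspace D" "D \<subseteq> V" "D \<noteq> V" "V - D \<subseteq> E"
  shows "D = {0}"
proof (rule invariant_subspace_trivial[OF assms(1-3)])
  fix a d assume "a \<in> V" "a \<notin> D" "d \<in> D"
  then show "a + d \<in> E"
    using assms subspace_V by (auto simp: subspace_addR subspace_add subsetD)
qed

end

locale indecomposable_hyperplane = indecomposable_matroid +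
  fixes H :: "'a set"
  assumes subspace_H: "subspace H" and H_subset: "H \<subseteq> V" and H_neq: "H \<noteq> V"
    and add_notin_H: "\<lbrakk>x \<in> V; y \<in> V; x \<notin> H; y \<notin> H\<rbrakk> \<Longrightarrow> x + y \<in> H"
begin

lemma add_VH: "\<lbrakk>x \<in> V - H; a \<in> H\<rbrakk> \<Longrightarrow> x + a \<in> V - H"
  using subspace_V subspace_H H_subset by (auto simp: subspace_add subspace_addR)

lemma H_add: "\<lbrakk>u \<in> H; v \<in> H\<rbrakk> \<Longrightarrow> u + v \<in> H"
  using subspace_add[OF subspace_H] .

end

section \<open>Stabilizers on the cosets of \<open>F\<close> outside \<open>H\<close>\<close>

locale hyperplane_decomposer = indecomposable_hyperplane +
  fixes F :: "'a set"
  assumes subspace_F: "subspace F" and F_subset: "F \<subseteq> H" and F_neq: "F \<noteq> H" and F_nontrivial: "F \<noteq> {0}"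
    and F_unmixed: "\<lbrakk>a \<in> H; a \<notin> F; u \<in> F\<rbrakk> \<Longrightarrow> a + u \<in> E \<longleftrightarrow> a \<in> E"
begin

declare add_VH [simp]

text \<open>The quantifier over \<open>v\<close> makes the set depend on the coset
  \<open>x + F\<close> alone. Without it, the set need not be a subspace.\<close>

definition stab :: "'a \<Rightarrow> 'a set" where
  "stab x = {u \<in> F. \<forall>v\<in>F. x + v + u \<in> E \<longleftrightarrow> x + v \<in> E}"

lemma F_in_H: "u \<in> F \<Longrightarrow> u \<in> H"
  using F_subset by blast

lemma F_add: "\<lbrakk>u \<in> F; v \<in> F\<rbrakk> \<Longrightarrow> u + v \<in> F"
  using subspace_add[OF subspace_F] .

lemma add_notin_F: "\<lbrakk>a \<notin> F; u \<in> F\<rbrakk> \<Longrightarrow> a + u \<notin> F"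
  using subspace_F by (simp add: subspace_addR)

lemma zero_in_F [simp]: "0 \<in> F"
  using subspace_0[OF subspace_F] .

lemma stab_subset: "stab x \<subseteq> F"
  unfolding stab_def by blast

lemma stabD: "\<lbrakk>u \<in> stab x; v \<in> F\<rbrakk> \<Longrightarrow> x + v + u \<in> E \<longleftrightarrow> x + v \<in> E"
  unfolding stab_def by blast

lemma stabD0: "u \<in> stab x \<Longrightarrow> x + u \<in> E \<longleftrightarrow> x \<in> E"
  using stabD[of u x 0] by simp

lemma subspace_stab: "subspace (stab x)"
  unfolding subspace_iff
proof (intro conjI ballI)
  show "0 \<in> stab x" by (simp add: stab_def)
next
  fix u w assume u: "u \<in> stab x" and w: "w \<in> stab x"
  have "x + v + (u + w) \<in> E \<longleftrightarrow> x + v \<in> E" if "v \<in> F" for v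
  proof -
    have "v + u \<in> F" using that u F_add stab_subset by blast
    then show ?thesis
      using stabD[OF w, of "v + u"] stabD[OF u that] by (simp add: add.assoc)
  qed
  then show "u + w \<in> stab x"
    using u w F_add unfolding stab_def by blast
qed

lemma stab_cong:
  assumes "x + y \<in> F"
  shows "stab x = stab y"
proof -
  have *: "stab a \<subseteq> stab b" if "a + b \<in> F" for a b
  proof
    fix u assume u: "u \<in> stab a"
    have "b + v + u \<in> E \<longleftrightarrow> b + v \<in> E" if "v \<in> F" for v
    proof -
      have "a + (a + b + v) = b + v" by (simp add: char2)
      then show ?thesis
        using stabD[OF u F_add[OF \<open>a + b \<in> F\<close> that]] by metis
    qed
    then show "u \<in> stab b" using u by (auto simp: stab_def)
  qed
  show ?thesis
    using *[of x y] *[of y x] assms by (simp add: add.commute)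
qed

lemma not_stabE:
  assumes "u \<notin> stab x" "u \<in> F"
  obtains v where "v \<in> F" "x + v \<in> E" "x + v + u \<notin> E"
proof -
  obtain v where v: "v \<in> F" "(x + v + u \<in> E) \<noteq> (x + v \<in> E)"
    using assms unfolding stab_def by blast
  show ?thesis
  proof (cases "x + v \<in> E")
    case True then show ?thesis using that v by blast
  next
    case False
    have "x + (v + u) + u = x + v" by (simp add: char2)
    then show ?thesis
      using that[of "v + u"] False v F_add assms by (simp add: add.assoc)
  qed
qed

lemma stab_eq_F:
  assumes "stab x = F" "u \<in> F" "v \<in> F"
  shows "x + u \<in> E \<longleftrightarrow> x + v \<in> E"
  using assms stabD0[of u x] stabD0[of v x] by blast

lemma stab_neq_F:
  assumes "stab x \<noteq> F"
  obtains u v where "u \<in> F" "v \<in> F" "x + u \<in> E" "x + v \<notin> E"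
proof -
  obtain w where "w \<in> F" "w \<notin> stab x" using assms stab_subset by blast
  then obtain v where "v \<in> F" "x + v \<in> E" "x + v + w \<notin> E" using not_stabE by blast
  then show ?thesis using that[of v "v + w"] F_add \<open>w \<in> F\<close> by (simp add: add.assoc)
qed

lemma sum_unmixed:
  assumes "x \<in> V - H" "y \<in> V - H" "x + y \<notin> F" "u \<in> F"
  shows "x + y + u \<in> E \<longleftrightarrow> x + y \<in> E"
  using F_unmixed add_notin_H assms by blast

text \<open>The suffixes are the forbidden membership patterns on the pair \<open>x + v\<close>, \<open>x + v + u\<close> when the coset
  of \<open>y\<close> contains a pair \<open>w\<close>, \<open>w + u\<close> with exactly one element in \<open>E\<close>.\<close>

lemma flip_00:
  assumes "x \<in> V - H" "y \<in> V - H" "x + y \<notin> F" "x + y \<in> E"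
    and "u \<in> F" "u \<notin> E" "u \<notin> stab y" "v \<in> F"
  shows "x + v \<in> E \<or> x + v + u \<in> E"
proof (rule ccontr)
  assume a: "\<not> ?thesis"
  obtain w where w: "w \<in> F" "y + w \<in> E" "y + w + u \<notin> E" using not_stabE assms by blast
  have "x + y + (v + w) \<in> E" "x + y + (v + w + u) \<in> E"
    using assms w F_add by (metis sum_unmixed)+
  then show False
    using no_claw[of "x + y + (v + w)" "x + y + (v + w + u)" "y + w"] w a assms
    by (simp add: char2)
qed

lemma flip_11:
  assumes "x \<in> V - H" "y \<in> V - H" "x + y \<notin> F" "x + y \<notin> E"
    and "u \<in> F" "u \<notin> E" "u \<notin> stab y" "v \<in> F"
  shows "x + v \<notin> E \<or> x + v + u \<notin> E"
proof (rule ccontr)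
  assume a: "\<not> ?thesis"
  obtain w where w: "w \<in> F" "y + w \<in> E" "y + w + u \<notin> E" using not_stabE assms by blast
  have "x + y + (v + w) \<notin> E" "x + y + (v + w + u) \<notin> E"
    using assms w F_add by (metis sum_unmixed)+
  then show False
    using no_claw[of "x + v" "x + v + u" "y + w"] w a assms
    by (simp add: char2)
qed

lemma flip_01:
  assumes "x \<in> V - H" "y \<in> V - H" "x + y \<notin> F" "x + y \<notin> E"
    and "u \<in> F" "u \<in> E" "u \<notin> stab y"
  shows "u \<in> stab x"
proof (rule ccontr)
  assume a: "u \<notin> stab x"
  obtain w where w: "w \<in> F" "y + w \<in> E" "y + w + u \<notin> E" using not_stabE assms by blast
  obtain v where v: "v \<in> F" "x + v \<in> E" "x + v + u \<notin> E" using not_stabE assms a by blast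
  have "x + y + (v + w) \<notin> E" "x + y + (v + w + u) \<notin> E"
    using assms v w F_add by (metis sum_unmixed)+
  then show False
    using no_claw[of "x + v" u "y + w"] w v assms
    by (simp add: char2)
qed

section \<open>The subspace spanned by \<open>F\<close> and a point outside \<open>H\<close>\<close>

definition cone :: "'a \<Rightarrow> 'a set" where
  "cone x = {y. y \<in> F \<or> y + x \<in> F}"

lemma subspace_cone: "subspace (cone x)"
  unfolding cone_def by (rule subspace_Un_coset[OF subspace_F])

lemma cone_cases:
  assumes "y \<in> cone x"
  obtains "y \<in> F" | u where "u \<in> F" "y = x + u"
  using assms unfolding cone_def by (metis (mono_tags, lifting) add.commute add_self_left mem_Collect_eq)

lemma in_cone: "x \<in> cone x" "F \<subseteq> cone x"
  unfolding cone_def by auto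

lemma cone_Int_H: "\<lbrakk>x \<in> V - H; a \<in> H; a \<in> cone x\<rbrakk> \<Longrightarrow> a \<in> F"
  using add_VH F_in_H by (metis DiffD2 cone_cases)

lemma cone_subset: "x \<in> V - H \<Longrightarrow> cone x \<subseteq> V"
  using cone_cases add_VH F_in_H H_subset by (metis DiffD1 subset_iff)

lemma cone_proper: "x \<in> V - H \<Longrightarrow> cone x \<noteq> V"
  using cone_Int_H F_neq F_subset H_subset by blast

lemma cone_nontrivial: "cone x \<noteq> {0}"
  using in_cone F_nontrivial zero_in_F by blast

text \<open>The form of \<open>uniform_cosets_empty\<close> for \<open>cone x\<close>. Every coset
  of \<open>cone x\<close> in \<open>V\<close> is the union of \<open>a + F\<close> and
  \<open>x + a + F\<close> for some \<open>a\<close> in \<open>H\<close>. For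
  \<open>a \<notin> F\<close> the first half is unmixed, so uniformity and mixedness are read off by
  comparing the second half with \<open>a\<close>.\<close>

lemma uniform_cone_cosets_empty:
  assumes x: "x \<in> V - H"
    and mix: "\<And>m a u. \<lbrakk>m \<in> H; m \<notin> F; a \<in> H; a \<notin> F; m + a \<notin> F; (a \<in> E) = b;
      \<And>u. u \<in> F \<Longrightarrow> (x + a + u \<in> E) = b; u \<in> F; (x + m + u \<in> E) \<noteq> (m \<in> E)\<rbrakk>
      \<Longrightarrow> (m + a \<in> E) = b \<and> (\<forall>u\<in>F. (x + m + a + u \<in> E) = b)"
    and a: "a \<in> H" "a \<notin> F" "(a \<in> E) = b" "\<And>u. u \<in> F \<Longrightarrow> (x + a + u \<in> E) = b"
  shows False
proof -
  define good where "good a \<longleftrightarrow> a \<in> H \<and> a \<notin> F \<and> (a \<in> E) = b \<and> (\<forall>u\<in>F. (x + a + u \<in> E) = b)" for a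
  have good_unif: "(a + r \<in> E) = b" if "good a" "r \<in> cone x" for a r
    using that(2)
  proof (cases rule: cone_cases)
    case 1
    then show ?thesis using that F_unmixed unfolding good_def by blast
  next
    case (2 u)
    then have "a + r = x + a + u" by (simp add: char2)
    then show ?thesis using that 2 unfolding good_def by metis
  qed
  have unif_good: "good a" if "a \<in> H" "a \<notin> cone x" "\<forall>r\<in>cone x. (a + r \<in> E) = b" for a
  proof -
    have "a + 0 \<in> E \<longleftrightarrow> b" using that in_cone zero_in_F by blast
    moreover have "x + a + u \<in> E \<longleftrightarrow> b" if "u \<in> F" for u
    proof -
      have "a + (x + u) = x + a + u" "x + u \<in> cone x"
        using that by (simp_all add: char2 cone_def)
      then show ?thesis using \<open>\<forall>r\<in>cone x. (a + r \<in> E) = b\<close> by metis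
    qed
    ultimately show ?thesis
      using that in_cone(2)[of x] unfolding good_def by auto
  qed
  have key: "m + a \<notin> cone x \<and> (\<forall>r\<in>cone x. (m + a + r \<in> E) = b)"
    if m: "m \<in> H" "m \<notin> cone x" "r \<in> cone x" "(m + r \<in> E) \<noteq> (m \<in> E)"
      and g: "good a" for m a r
  proof -
    have mF: "m \<notin> F" using m in_cone by blast
    obtain u where u: "u \<in> F" "(x + m + u \<in> E) \<noteq> (m \<in> E)"
      using m(3)
    proof (cases rule: cone_cases)
      case 1
      then show ?thesis using F_unmixed m mF by blast
    next
      case (2 u)
      then have "x + m + u = m + r" by (simp add: char2)
      then show ?thesis using that 2 m by metis
    qed
    \<comment> \<open>Otherwise \<open>m\<close> and \<open>a\<close> would share a coset of
      \<open>cone x\<close>, which cannot be both mixed and uniform.\<close>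
    have maF: "m + a \<notin> F"
    proof
      assume f: "m + a \<in> F"
      then have "(a + (m + a) \<in> E) = b" "(x + a + (m + a + u) \<in> E) = b"
        using g u F_add F_unmixed unfolding good_def by auto
      then show False using u by (simp add: char2)
    qed
    have "good (m + a)"
      using mix[of m a u] m mF u g maF H_add unfolding good_def by (simp add: add.assoc)
    then show ?thesis
      using good_unif cone_Int_H[OF x] unfolding good_def by blast
  qed
  show False
  proof (rule uniform_cosets_empty[of "cone x" b a])
    show "a \<in> V" "a \<notin> cone x" "\<forall>r\<in>cone x. (a + r \<in> E) = b"
      using a H_subset cone_Int_H[OF x] good_unif[of a] unfolding good_def by auto
    fix m a r
    assume m: "m \<in> V" "m \<notin> cone x" "r \<in> cone x" "(m + r \<in> E) \<noteq> (m \<in> E)"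
      and a: "a \<in> V" "a \<notin> cone x" "\<forall>r\<in>cone x. (a + r \<in> E) = b"
    \<comment> \<open>Adding \<open>x\<close> stays in the same coset of \<open>cone x\<close> and
      brings a representative into \<open>H\<close>.\<close>
    have shift: "x + y \<in> H" "x + y \<notin> cone x" if "y \<in> V" "y \<notin> H" "y \<notin> cone x" for y
      using that x add_notin_H subspace_addL[OF subspace_cone in_cone(1)] by auto
    obtain a' s where a': "good a'" "a = a' + s" "s \<in> cone x"
    proof (cases "a \<in> H")
      case True
      then show ?thesis
        using that[of a 0] unif_good[of a] a subspace_0[OF subspace_cone] by simp
    next
      case False
      have "\<forall>r\<in>cone x. (x + a + r \<in> E) = b"
      proof
        fix r assume "r \<in> cone x"
        then have "x + r \<in> cone x" using subspace_add[OF subspace_cone in_cone(1)] by blast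
        moreover have "a + (x + r) = x + a + r" by (simp add: char2)
        ultimately show "(x + a + r \<in> E) = b" using a by metis
      qed
      then show ?thesis
        using that[of "x + a" x] unif_good[of "x + a"] shift[of a] False a in_cone by (simp add: char2)
    qed
    obtain m' t r' where m': "m' \<in> H" "m' \<notin> cone x" "r' \<in> cone x" "(m' + r' \<in> E) \<noteq> (m' \<in> E)"
      and t: "m = m' + t" "t \<in> cone x"
    proof (cases "m \<in> H")
      case True
      then show ?thesis
        using that[of m r 0] m subspace_0[OF subspace_cone] by simp
    next
      case False
      define m' where "m' = x + m"
      have e: "m' + x = m" "m' + (x + r) = m + r" unfolding m'_def by (simp_all add: char2)
      have "x + r \<in> cone x" using m subspace_add[OF subspace_cone in_cone(1)] by blast
      moreover have "m' \<in> H" "m' \<notin> cone x" using shift False m unfolding m'_def by auto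
      ultimately show ?thesis
        using that[of m' x x] that[of m' "x + r" x] e m in_cone(1) by metis
    qed
    have st: "s + t \<in> cone x" using a' t subspace_add[OF subspace_cone] by blast
    have k: "m' + a' \<notin> cone x" "\<And>r. r \<in> cone x \<Longrightarrow> (m' + a' + r \<in> E) = b"
      using key[OF m' a'(1)] by auto
    have eq: "m + a = m' + a' + (s + t)" using t a' by (simp add: char2)
    have "m + a \<notin> cone x"
      unfolding eq using k st subspace_addR[OF subspace_cone] by blast
    moreover have "(m + a + r \<in> E) = b" if "r \<in> cone x" for r
      using k(2)[OF subspace_add[OF subspace_cone st that]] unfolding eq by (simp add: add.assoc)
    ultimately show "m + a \<notin> cone x \<and> (\<forall>r\<in>cone x. (m + a + r \<in> E) = b)" by blast
  qed (use subspace_cone cone_subset x cone_nontrivial in auto)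
qed

text \<open>Otherwise \<open>K - {0}\<close> would be a decomposer: its cosets in
  \<open>H - F\<close> are unmixed because \<open>K \<subseteq> F\<close>, those outside
  \<open>H\<close> by stabilization, and those inside \<open>F\<close> by the last
  hypothesis.\<close>

lemma common_stab_trivial:
  assumes K: "subspace K" "K \<subseteq> F" "\<And>x. x \<in> V - H \<Longrightarrow> K \<subseteq> stab x"
    and F: "\<And>a d. \<lbrakk>a \<in> F; a \<notin> K; d \<in> K; a \<in> E\<rbrakk> \<Longrightarrow> a + d \<in> E"
  shows "K = {0}"
proof (rule invariant_subspace_trivial[OF K(1)])
  show "K \<subseteq> V" "K \<noteq> V"
    using K(2) F_subset H_subset F_neq by auto
  fix a d assume a: "a \<in> V" "a \<notin> K" "d \<in> K" "a \<in> E"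
  show "a + d \<in> E"
  proof (cases "a \<in> H")
    case True
    then show ?thesis using F[of a d] F_unmixed[of a d] a K(2) by blast
  next
    case False
    then show ?thesis using K(3)[of a] stabD0[of d a] a by blast
  qed
qed

section \<open>The case in which all of \<open>F - E\<close> stabilizes every coset outside
  \<open>H\<close>\<close>

lemma mixed_coset_exists:
  obtains x where "x \<in> V - H" "stab x \<noteq> F"
  using common_stab_trivial[OF subspace_F] F_nontrivial by blast

text \<open>By \<open>claw_pattern1\<close>, applied through the non-element \<open>x + v0\<close>,
  the cosets \<open>x + m + F\<close> and \<open>x + m + a + F\<close> are constant with a common
  value. The point \<open>x + m + w\<close> makes both empty, and then \<open>m\<close>,
  \<open>m + a\<close>, \<open>x + v1\<close> is a claw.\<close>

lemma claw_pattern1_cosets: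
  assumes "m \<in> H" "m \<notin> F" "a \<in> H" "a \<notin> F" "m + a \<notin> F"
    and E: "m \<in> E" "a \<notin> E" "m + a \<in> E" "\<And>u. u \<in> F \<Longrightarrow> x + a + u \<notin> E"
    and v: "v0 \<in> F" "x + v0 \<notin> E" "v1 \<in> F" "x + v1 \<in> E" "w \<in> F" "x + m + w \<notin> E"
  shows False
proof -
  have eq: "x + m + u1 \<in> E \<longleftrightarrow> x + m + a + u2 \<in> E" if u: "u1 \<in> F" "u2 \<in> F" for u1 u2
  proof -
    have "m + (u1 + v0) \<in> E" "a + (u1 + u2) \<notin> E" "m + a + (v0 + u2) \<in> E" "x + a + (v0 + u1 + u2) \<notin> E"
      using F_unmixed assms u F_add H_add by simp_all
    then show ?thesis
      using claw_pattern1[of "m + (u1 + v0)" "a + (u1 + u2)" "x + v0"] v by (simp add: char2)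
  qed
  have "x + m + a + v1 \<notin> E" "x + m + v1 \<notin> E"
    using eq[of w v1] eq[of v1 v1] v by blast+
  then show False
    using no_claw[of m "m + a" "x + v1"] E(1-3) E(4)[of v1] v by (simp add: char2)
qed

text \<open>Everything in \<open>F\<close> outside the proper subspace \<open>stab x\<close> lies in
  \<open>stab y\<close>, and the complement of a proper subspace spans the whole space.\<close>

lemma unmixed_if_stab:
  assumes stab: "\<And>x u. \<lbrakk>x \<in> V - H; u \<in> F; u \<notin> E\<rbrakk> \<Longrightarrow> u \<in> stab x"
    and x: "x \<in> V - H" "stab x \<noteq> F" and y: "y \<in> V - H" "x + y \<notin> F" "x + y \<notin> E"
  shows "stab y = F"
proof
  obtain w where w: "w \<in> F" "w \<notin> stab x" using x stab_subset by blast
  have *: "u \<in> stab y" if "u \<in> F" "u \<notin> stab x" for u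
    using flip_01[of y x u] stab[of x u] that x y by (auto simp: add.commute)
  show "F \<subseteq> stab y"
  proof
    fix u assume u: "u \<in> F"
    show "u \<in> stab y"
    proof (cases "u \<in> stab x")
      case True
      then have "u + w \<notin> stab x" using w subspace_addL[OF subspace_stab] by blast
      then have "u + w \<in> stab y" "w \<in> stab y" using * w u F_add by blast+
      then show ?thesis using subspace_addR[OF subspace_stab] by blast
    qed (use * u in blast)
  qed
qed (rule stab_subset)

text \<open>The common stabilizer is trivial, so \<open>F - {0} \<subseteq> E\<close>. For a
  non-element \<open>a\<close> of \<open>H - F\<close> the coset \<open>x + a + F\<close> is unmixed
  and, by the cone argument, full. A triangle of non-elements in \<open>H\<close> would therefore
  give the claw \<open>x + v0 + p\<close>, \<open>x + v0 + q\<close>, \<open>x + v0 + p + q\<close>,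
  whose sum is the non-element \<open>x + v0\<close>.\<close>

lemma no_triangle_in_complement_if_stab:
  assumes stab: "\<And>x u. \<lbrakk>x \<in> V - H; u \<in> F; u \<notin> E\<rbrakk> \<Longrightarrow> u \<in> stab x"
    and "p \<in> V" "q \<in> V" "p \<notin> E" "q \<notin> E" "p + q \<notin> E"
  shows "p = 0 \<or> q = 0 \<or> p = q"
proof (rule ccontr)
  assume neq: "\<not> ?thesis"
  define K where "K = {u \<in> F. \<forall>x\<in>V-H. u \<in> stab x}"
  have sK: "subspace K"
    unfolding K_def subspace_iff
    using F_add subspace_add[OF subspace_stab] subspace_0[OF subspace_stab] by auto
  have "K = {0}"
  proof (rule common_stab_trivial[OF sK])
    fix a d assume "a \<in> F" "a \<notin> K" "d \<in> K" "a \<in> E"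
    then have "a + d \<notin> K" "a + d \<in> F"
      using subspace_addR[OF sK] F_add by (blast, simp add: K_def)
    then show "a + d \<in> E" using stab unfolding K_def by blast
  qed (auto simp: K_def)
  then have FE: "u \<in> E" if "u \<in> F" "u \<noteq> 0" for u
    using stab that unfolding K_def by blast
  obtain x where x: "x \<in> V - H" "stab x \<noteq> F" using mixed_coset_exists .
  obtain v0 v1 where v: "v0 \<in> F" "x + v0 \<notin> E" "v1 \<in> F" "x + v1 \<in> E"
    using stab_neq_F x by metis
  have unm: "stab y = F" if "y \<in> V - H" "x + y \<notin> F" "x + y \<notin> E" for y
    using unmixed_if_stab[OF stab] x that by blast
  have unm': "x + a + u \<in> E \<longleftrightarrow> x + a \<in> E" if "a \<in> H" "a \<notin> F" "a \<notin> E" "u \<in> F" for a u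
    using unm[OF add_VH[OF x(1)], of a] stab_eq_F[of "x + a" u 0] that by simp
  have no_B: False if a: "a \<in> H" "a \<notin> F" "a \<notin> E" "\<And>u. u \<in> F \<Longrightarrow> x + a + u \<notin> E" for a
  proof (rule uniform_cone_cosets_empty[OF x(1), of False a])
    fix m a w
    assume m: "m \<in> H" "m \<notin> F" and a: "a \<in> H" "a \<notin> F" and ma: "m + a \<notin> F"
      and aE: "(a \<in> E) = False" "\<And>u. u \<in> F \<Longrightarrow> (x + a + u \<in> E) = False"
      and w: "w \<in> F" "(x + m + w \<in> E) \<noteq> (m \<in> E)"
    have maH: "m + a \<in> H" using m a H_add by blast
    have maE: "m + a \<notin> E"
    proof
      assume c: "m + a \<in> E"
      show False
      proof (cases "m \<in> E")
        case True
        then show False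
          using claw_pattern1_cosets[of m a x v0 v1 w] m a ma aE c v w by blast
      next
        case False
        have "x + v \<in> E \<longleftrightarrow> x + m + a + (u + v) \<in> E" if "u \<in> F" "v \<in> F" for u v
        proof -
          have "a + u \<notin> E" "m + a + u \<in> E" "x + m + v \<in> E" "x + a + (u + v) \<notin> E"
            using that F_unmixed a aE c ma maH F_add unm'[of m] w m False by simp_all
          then show ?thesis
            using claw_pattern2[of m "a + u" "x + v"] False by (simp add: char2)
        qed
        from this[of v0 v1] this[of v1 v0] show False
          using v by (simp add: char2)
      qed
    qed
    moreover have "x + m + a + u \<notin> E" if "u \<in> F" for u
    proof
      assume "x + m + a + u \<in> E"
      then have y: "x + m + a \<in> E"
        using unm'[of "m + a" u] maH ma maE that by (simp add: add.assoc)
      have maF: "m + a + v \<notin> E" if "v \<in> F" for v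
        using F_unmixed[of "m + a" v] maH ma maE that by blast
      show False
      proof (cases "m \<in> E")
        case False
        have "m + v1 \<notin> E" "x + m \<in> E"
          using F_unmixed[of m v1] m False v unm'[of m] w by auto
        then show False
          using no_claw[of "x + v1" "x + m" "x + m + a"] y v maF[of v1] aE(2)[of v1] aE(1) by (simp add: char2)
      next
        case True
        have "m + (v1 + w) \<in> E" "a + w \<notin> E" "x + a + (v1 + w) \<notin> E"
          using F_unmixed m a True v w F_add aE by simp_all
        then show False
          using no_claw[of "x + v1" "m + (v1 + w)" "x + m + a"] y v maF[of v1] w True by (simp add: char2)
      qed
    qed
    ultimately show "(m + a \<in> E) = False \<and> (\<forall>u\<in>F. (x + m + a + u \<in> E) = False)" by blast
  qed (use a in auto)
  have inE: "x + a + u \<in> E" if "a \<in> H" "a \<notin> F" "a \<notin> E" "u \<in> F" for a u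
    using no_B[of a] unm'[of a] that by metis
  have inE': "y \<in> E" if "y \<in> V - H" "x + y \<notin> F" "x + y \<notin> E" for y
    using inE[of "x + y" 0] add_notin_H[of x y] x that by simp
  have inX: False if p: "p \<in> V - H" "q \<in> V - H" "p \<noteq> q" "p \<notin> E" "q \<notin> E" "p + q \<notin> E" for p q
  proof -
    have H: "p + q \<in> H" using add_notin_H p by blast
    have r: "p + q \<notin> F" using FE p by (metis add_eq_0)
    \<comment> \<open>If \<open>p\<close> were in \<open>x + F\<close>, then \<open>x + q\<close>
      would lie in the unmixed coset \<open>p + q + F\<close>, hence outside \<open>E\<close>, and
      \<open>inE'\<close> would put \<open>q\<close> into \<open>E\<close>.\<close>
    have away: "x + p \<notin> F" if "p \<in> V - H" "q \<in> V - H" "q \<notin> E" "p + q \<notin> E" "p + q \<notin> F" for p q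
    proof
      assume f: "x + p \<in> F"
      have "p + q + (x + p) \<notin> F" "p + q + (x + p) \<notin> E"
        using add_notin_F f that F_unmixed add_notin_H[of p q] by auto
      then show False using inE'[of q] that by (simp add: char2)
    qed
    have "x + p \<notin> F" "x + q \<notin> F"
      using away[of p q] away[of q p] p r by (auto simp: add.commute)
    moreover from this have "x + p \<in> E" "x + q \<in> E"
      using inE' p by blast+
    ultimately have "x + p + v0 \<in> E" "x + q + v0 \<in> E"
      using F_unmixed add_notin_H x p v by auto
    moreover have "x + (p + q) + v0 \<in> E" using inE r H p v by blast
    ultimately show False
      using no_claw[of "x + v0 + p" "x + v0 + q" "x + v0 + p + q"] p v by (simp add: char2)
  qed
  show False
  \<comment> \<open>A triangle not contained in \<open>H\<close> has exactly two points outside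
    \<open>H\<close>, so \<open>inX\<close> settles the last three cases.\<close>
  proof (cases "p \<in> H"; cases "q \<in> H")
    assume h: "p \<in> H" "q \<in> H"
    then have "p + q \<in> H" using H_add by blast
    moreover have "p \<notin> F" "q \<notin> F" "p + q \<notin> F" using FE assms neq by (metis add_eq_0)+
    ultimately have "x + p + v0 \<in> E" "x + q + v0 \<in> E" "x + (p + q) + v0 \<in> E"
      using inE h assms v by blast+
    then show False
      using no_claw[of "x + v0 + p" "x + v0 + q" "x + v0 + p + q"] assms v by (simp add: char2)
  next
    assume h: "p \<in> H" "q \<notin> H"
    then have "q + p \<in> V - H" using add_VH assms by blast
    then show False using inX[of q "q + p"] h assms neq by (simp add: char2)
  next
    assume h: "p \<notin> H" "q \<in> H"
    then have "p + q \<in> V - H" using add_VH assms by blast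
    then show False using inX[of p "p + q"] h assms neq by (simp add: char2)
  next
    assume h: "p \<notin> H" "q \<notin> H"
    then show False using inX[of p q] assms neq by blast
  qed
qed

section \<open>PG-sums from two cosets of \<open>F\<close>\<close>

lemma two_coset_stab:
  assumes x: "x \<in> V - H" "x \<in> E" and y: "y \<in> V - H" "y \<in> E" and xy: "x + y \<notin> F" "x + y \<notin> E"
    and u: "u \<in> F" "u \<notin> E" "v \<in> F" "x + v \<in> E" "x + v + u \<in> E"
  shows "u \<in> stab x" "u \<in> stab y"
proof -
  show y': "u \<in> stab y"
    using flip_11[of x y u v] assms by blast
  \<comment> \<open>Now \<open>y\<close>, \<open>y + u\<close> is a pair of elements in the other
    coset, and the same argument runs in the opposite direction.\<close>
  then have "y + u \<in> E" using stabD0 y by blast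
  then show "u \<in> stab x"
    using flip_11[of y x u 0] assms by (auto simp: add.commute)
qed

text \<open>With \<open>v = 0\<close> it puts all differences from \<open>x\<close> within
  \<open>E \<inter> (x + F)\<close> into \<open>stab x\<close>. If some \<open>u\<close> failed,
  every element of \<open>E\<close>, translated into \<open>F\<close> by \<open>x\<close> or
  \<open>y\<close> where necessary, would land in \<open>stab y\<close>. Then \<open>E\<close> would
  lie in the proper subspace spanned by \<open>stab y\<close>, \<open>x\<close> and
  \<open>y\<close>.\<close>

lemma two_coset_closed:
  assumes x: "x \<in> V - H" "x \<in> E" and y: "y \<in> V - H" "y \<in> E" and xy: "x + y \<notin> F" "x + y \<notin> E"
    and cover: "\<And>e. e \<in> E \<Longrightarrow> e \<in> F \<or> e + x \<in> F \<or> e + y \<in> F"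
    and u: "u \<in> F" "v \<in> F" "x + v \<in> E" "x + v + u \<in> E"
    and proper: "stab y \<noteq> F"
  shows "u \<in> stab x"
proof (rule ccontr)
  assume ux: "u \<notin> stab x"
  have yx: "y + x \<notin> F" "y + x \<notin> E" using xy by (simp_all add: add.commute)
  note Sx = subspace_stab[of x] and Sy = subspace_stab[of y]
  have union: "e \<in> stab x \<or> e \<in> stab y" if "e \<in> F" "e \<in> E" for e
    using flip_01[of x y e] that x y xy by blast
  have uy: "u \<in> stab y"
    using two_coset_stab(1)[OF x y xy, of u v] union u ux by blast
  \<comment> \<open>A counterexample \<open>c\<close> lies only in \<open>stab x\<close> while
    \<open>u\<close> lies only in \<open>stab y\<close>, so \<open>c + u\<close> lies in neither.
    But \<open>y\<close> and \<open>y + c + u\<close> are both in \<open>E\<close>, which forces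
    \<open>c + u\<close> into a stabilizer.\<close>
  have C: "c \<in> stab y" if c: "c \<in> F" "y + c \<in> E" for c
  proof (rule ccontr)
    assume n: "c \<notin> stab y"
    then have "c \<in> E" using two_coset_stab(1)[OF y x yx, of c 0] c y by auto
    then have "c \<in> stab x" using union n c by blast
    then have "c + u \<notin> stab x" "c + u \<notin> stab y"
      using n ux uy subspace_addL[OF Sx] subspace_addR[OF Sy] by blast+
    moreover have "y + c + u \<in> E" using stabD[OF uy] c by blast
    ultimately show False
      using two_coset_stab(1)[OF y x yx, of "c + u" 0] union[of "c + u"] c u y F_add
      by (auto simp: add.assoc)
  qed
  have A: "a \<in> stab y" if a: "a \<in> F" "x + a \<in> E" for a
  proof (rule ccontr)
    assume n: "a \<notin> stab y"
    then have "a \<in> E" using two_coset_stab(2)[OF x y xy, of a 0] a x by auto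
    then have ax: "a \<in> stab x" using union n a by blast
    then have "u + a \<notin> stab x" "u + a \<notin> stab y"
      using n ux uy subspace_addR[OF Sx] subspace_addL[OF Sy] by blast+
    moreover have "x + (v + u) + a \<in> E"
      using stabD[OF ax, of "v + u"] u F_add by (simp add: add.assoc)
    ultimately show False
      using two_coset_stab(2)[OF x y xy, of "u + a" v] union[of "u + a"] a u F_add
      by (auto simp: add.assoc)
  qed
  have B: "e \<in> stab y" if "e \<in> F" "e \<in> E" for e
    using union[OF that] A[of e] stabD0[of e x] x that by blast
  define D where "D = {z. z \<in> {z. z \<in> stab y \<or> z + x \<in> stab y} \<or> z + y \<in> {z. z \<in> stab y \<or> z + x \<in> stab y}}"
  have sD: "subspace D"
    unfolding D_def by (intro subspace_Un_coset Sy)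
  have D_H: "d \<in> stab y" if "d \<in> F" "d \<in> D" for d
  proof -
    have "d + x \<notin> F" "d + y \<notin> F"
      using that add_VH[of x d] add_VH[of y d] x y F_in_H by (auto simp: add.commute)
    moreover have "d + y + x \<notin> F"
      using that add_notin_F[OF xy(1), of d] by (simp add: char2)
    ultimately show ?thesis using that stab_subset unfolding D_def by blast
  qed
  have "D = {0}"
  proof (rule subspace_containing_E[OF sD])
    have SV: "z \<in> V" if "z \<in> stab y" for z
      using that stab_subset F_in_H H_subset by blast
    have "z \<in> V" if "z + x \<in> V" "x \<in> V" for z x
      using that subspace_addR[OF subspace_V] by blast
    then show "D \<subseteq> V"
      using SV x y unfolding D_def by blast
    show "D \<noteq> V"
      using D_H proper stab_subset F_subset H_subset by blast
    show "E \<subseteq> D"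
    proof
      fix e assume e: "e \<in> E"
      then have "x + (e + x) \<in> E" "y + (e + y) \<in> E" by (simp_all add: char2)
      then show "e \<in> D"
        using cover[OF e] A[of "e + x"] C[of "e + y"] B[of e] e unfolding D_def by auto
    qed
  qed
  moreover have "x \<in> D" using subspace_0[OF Sy] unfolding D_def by simp
  ultimately show False using x by auto
qed

text \<open>The summands are spanned by \<open>stab x\<close> with \<open>x\<close> and by
  \<open>stab y\<close> with \<open>y\<close>. They meet trivially because
  \<open>stab x \<inter> stab y\<close> stabilizes every coset outside \<open>H\<close>, and
  \<open>E \<inter> F\<close> consists of the nonzero elements of the two stabilizers.\<close>

lemma two_coset_PG_sum:
  assumes x: "x \<in> V - H" "x \<in> E" and y: "y \<in> V - H" "y \<in> E" and xy: "x + y \<notin> F" "x + y \<notin> E"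
    and cover: "\<And>z. z \<in> V - H \<Longrightarrow> z + x \<in> F \<or> z + y \<in> F"
    and EH: "\<And>e. e \<in> E \<Longrightarrow> e \<in> H \<Longrightarrow> e \<in> F"
    and proper: "stab x \<noteq> F" "stab y \<noteq> F"
  shows "\<exists>A B. subspace A \<and> subspace B \<and> A \<subseteq> V \<and> B \<subseteq> V \<and> A \<inter> B = {0} \<and> E = (A \<union> B) - {0}"
proof -
  have yx: "y + x \<notin> F" "y + x \<notin> E" using xy by (simp_all add: add.commute)
  have Sx: "subspace (stab x)" and Sy: "subspace (stab y)" by (rule subspace_stab)+
  have EF: "e \<in> F \<or> e + x \<in> F \<or> e + y \<in> F" if "e \<in> E" for e
    using cover EH that E_subset by blast
  have EF': "e \<in> F \<or> e + y \<in> F \<or> e + x \<in> F" if "e \<in> E" for e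
    using EF that by blast
  have union: "e \<in> stab x \<or> e \<in> stab y" if "e \<in> F" "e \<in> E" for e
    using flip_01[of x y e] that x y xy by blast
  have A: "u \<in> stab x" if "u \<in> F" "x + u \<in> E" for u
    using two_coset_closed[OF x y xy EF, of u 0] that x proper by simp
  have C: "u \<in> stab y" if "u \<in> F" "y + u \<in> E" for u
    using two_coset_closed[OF y x yx EF', of u 0] that y proper by simp
  define K where "K = stab x \<inter> stab y"
  have sK: "subspace K" unfolding K_def using Sx Sy subspace_inter by blast
  have nE: "u \<in> K" if "u \<in> F" "u \<notin> E" "u \<in> stab x \<or> u \<in> stab y" for u
    using that(3)
  proof
    assume "u \<in> stab x"
    then have "x + 0 + u \<in> E" using stabD0[of u x] x by simp
    then show ?thesis
      using two_coset_stab[OF x y xy that(1,2), of 0] x unfolding K_def by simp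
  next
    assume "u \<in> stab y"
    then have "y + 0 + u \<in> E" using stabD0[of u y] y by simp
    then show ?thesis
      using two_coset_stab[OF y x yx that(1,2), of 0] y unfolding K_def by simp
  qed
  have "K = {0}"
  proof (rule common_stab_trivial[OF sK])
    show "K \<subseteq> F" using stab_subset unfolding K_def by blast
    show "K \<subseteq> stab z" if "z \<in> V - H" for z
      using cover[OF that] stab_cong[of z x] stab_cong[of z y] unfolding K_def by blast
    fix a d assume a: "a \<in> F" "a \<notin> K" "d \<in> K" "a \<in> E"
    have "a + d \<in> stab x \<or> a + d \<in> stab y"
      using union[of a] a subspace_add[OF Sx] subspace_add[OF Sy] unfolding K_def by blast
    moreover have "a + d \<notin> K" using a subspace_addR[OF sK] by blast
    moreover have "a + d \<in> F" using a F_add stab_subset unfolding K_def by blast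
    ultimately show "a + d \<in> E" using nE by blast
  qed
  then have K0: "u = 0" if "u \<in> stab x" "u \<in> stab y" for u
    using that unfolding K_def by blast
  define P where "P = {z. z \<in> stab x \<or> z + x \<in> stab x}"
  define Q where "Q = {z. z \<in> stab y \<or> z + y \<in> stab y}"
  have "subspace P" "subspace Q"
    unfolding P_def Q_def by (intro subspace_Un_coset Sx Sy)+
  moreover have SV: "z \<in> V" if "z \<in> stab t" for z t
    using that stab_subset F_in_H H_subset by blast
  have "z \<in> V" if "z + t \<in> V" "t \<in> V" for z t
    using that subspace_addR[OF subspace_V] by blast
  then have "P \<subseteq> V" "Q \<subseteq> V"
    using SV x y unfolding P_def Q_def by blast+
  moreover have "P \<inter> Q = {0}"
  proof -
    have "z = 0" if z: "z \<in> P" "z \<in> Q" for z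
    proof -
      have nF: "z + x \<notin> F" "z + y \<notin> F" if "z \<in> F"
        using that add_VH[of x z] add_VH[of y z] x y F_in_H by (auto simp: add.commute)
      have "\<not> (z + x \<in> F \<and> z + y \<in> F)"
      proof
        assume "z + x \<in> F \<and> z + y \<in> F"
        then have "(z + x) + (z + y) \<in> F" using F_add by blast
        then show False using xy by (simp add: char2)
      qed
      then show ?thesis
        using z nF K0 stab_subset unfolding P_def Q_def by blast
    qed
    then show ?thesis
      using subspace_0[OF Sx] subspace_0[OF Sy] unfolding P_def Q_def by blast
  qed
  moreover have "E = (P \<union> Q) - {0}"
  proof (intro equalityI subsetI)
    fix e assume e: "e \<in> E"
    then have "x + (e + x) \<in> E" "y + (e + y) \<in> E" by (simp_all add: char2)
    then have "e \<in> P \<union> Q"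
      using EF[OF e] A[of "e + x"] C[of "e + y"] union[of e] e unfolding P_def Q_def by auto
    then show "e \<in> P \<union> Q - {0}" using e zero_notin_E by blast
  next
    fix z assume z: "z \<in> P \<union> Q - {0}"
    have eq: "x + (z + x) = z" "y + (z + y) = z" by (simp_all add: char2)
    consider "z \<in> stab x \<or> z \<in> stab y" | "z + x \<in> stab x" | "z + y \<in> stab y"
      using z unfolding P_def Q_def by blast
    then show "z \<in> E"
    proof cases
      case 1
      then show ?thesis using nE[of z] \<open>K = {0}\<close> z stab_subset by blast
    next
      case 2
      then show ?thesis using stabD0[OF 2] eq x by simp
    next
      case 3
      then show ?thesis using stabD0[OF 3] eq y by simp
    qed
  qed
  ultimately show ?thesis by blast
qed

text \<open>Here \<open>T = E - H\<close> is closed under sums of three elements, so \<open>T\<close> together with the stabilizer of \<open>T\<close> in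
  \<open>H\<close> is a proper subspace containing \<open>E\<close>.\<close>

lemma three_coset_contradiction:
  assumes x: "x \<in> E - H" and y: "y \<in> E - H" and z: "z \<in> E - H"
    and xyz: "x + y \<notin> F" "x + z \<notin> F" "y + z \<notin> F"
    and EH: "\<And>e. e \<in> E \<Longrightarrow> e \<in> H \<Longrightarrow> e \<in> F"
    and proper: "x0 \<in> V - H" "stab x0 \<noteq> F"
  shows False
proof -
  define T where "T = E - H"
  have TV: "t \<in> V - H" if "t \<in> T" for t using that E_subset unfolding T_def by blast
  have nE: "s + t \<notin> E" if "s \<in> T" "t \<in> T" "s + t \<notin> F" for s t
    using EH add_notin_H TV that by blast
  have TH: "t1 + t2 + t3 \<in> V - H" if "t1 \<in> T" "t2 \<in> T" "t3 \<in> T" for t1 t2 t3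
    using add_VH[of t3 "t1 + t2"] add_notin_H[of t1 t2] that TV by (simp add: char2)
  have trip: "t1 + t2 + t3 \<in> T"
    if "t1 \<in> T" "t2 \<in> T" "t3 \<in> T" "t1 + t2 \<notin> F" "t1 + t3 \<notin> F" "t2 + t3 \<notin> F" for t1 t2 t3
    using no_claw[of t1 t2 t3] nE that TH[of t1 t2 t3] unfolding T_def by blast
  have same: "s + (t1 + t2) \<in> T"
    if t: "t1 \<in> T" "t2 \<in> T" "s \<in> T" "r \<in> T" "t1 + t2 \<in> F" "t1 + s \<notin> F" "t1 + r \<notin> F" "s + r \<notin> F" for t1 t2 s r
  proof -
    \<comment> \<open>The auxiliary \<open>r\<close> enters two triple sums and cancels; it replaces
      the sum of \<open>t1\<close>, \<open>t2\<close>, \<open>s\<close>, where \<open>trip\<close>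
      fails because \<open>t1 + t2 \<in> F\<close>.\<close>
    have w: "t1 + s + r \<in> T" using trip t by blast
    have "t1 + s + r + t2 \<notin> F" "t2 + r \<notin> F" "t1 + s + r + r \<notin> F"
      using add_notin_F[of "s + r" "t1 + t2"] add_notin_F[of "t1 + r" "t1 + t2"] t by (simp_all add: char2)
    then have "t1 + s + r + t2 + r \<in> T" using trip[OF w, of t2 r] t by blast
    then show ?thesis by (simp add: char2)
  qed
  have eqv: "a + b \<in> F" if "a + c \<in> F" "b + c \<in> F" for a b c
  proof -
    have "(a + c) + (b + c) = a + b" by (simp add: char2)
    then show ?thesis using F_add[OF that] by metis
  qed
  have xyzT: "x \<in> T" "y \<in> T" "z \<in> T" using x y z unfolding T_def by blast+
  have other: "\<exists>r\<in>T. r + a \<notin> F \<and> r + b \<notin> F" for a b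
    using eqv xyz xyzT by metis
  have same': "s + (t1 + t2) \<in> T" if "t1 \<in> T" "t2 \<in> T" "t1 + t2 \<in> F" "s \<in> T" for s t1 t2
  proof (cases "t1 + s \<in> F")
    case False
    then show ?thesis using other[of t1 s] same[of t1 t2 s] that by (metis add.commute)
  next
    case True
    obtain r where r: "r \<in> T" "r + t1 \<notin> F" "r + s \<notin> F" using other by blast
    then obtain r' where r': "r' \<in> T" "r' + t1 \<notin> F" "r' + r \<notin> F" using other by blast
    have a: "r + (t1 + t2) \<in> T"
      using same[of t1 t2 r r'] that r r' by (simp add: add.commute)
    have sum: "r + (r + (t1 + t2)) = t1 + t2" by simp
    obtain r'' where r'': "r'' \<in> T" "r'' + r \<notin> F" "r'' + s \<notin> F" using other by blast
    show ?thesis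
      using same[of r "r + (t1 + t2)" s r''] a r r'' that unfolding sum by (simp add: add.commute)
  qed
  have TTT: "t1 + t2 + t3 \<in> T" if t: "t1 \<in> T" "t2 \<in> T" "t3 \<in> T" for t1 t2 t3
  proof -
    have "t3 + (t1 + t2) = t1 + t2 + t3" "t2 + (t1 + t3) = t1 + t2 + t3" "t1 + (t2 + t3) = t1 + t2 + t3"
      by (simp_all add: char2)
    then show ?thesis using trip[of t1 t2 t3] same' t by metis
  qed
  define Q where "Q = {q \<in> H. \<forall>t\<in>T. q + t \<in> T} \<union> T"
  have pair: "s + t \<in> {q \<in> H. \<forall>t\<in>T. q + t \<in> T}" if "s \<in> T" "t \<in> T" for s t
    using TTT add_notin_H TV that by blast
  have act: "q + t \<in> T" "t + q \<in> T" if "q \<in> {q \<in> H. \<forall>t\<in>T. q + t \<in> T}" "t \<in> T" for q t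
    using that by (auto simp: add.commute)
  have "subspace Q"
    unfolding subspace_iff
  proof (intro conjI ballI)
    show "0 \<in> Q" using subspace_0[OF subspace_H] unfolding Q_def by simp
    fix p q assume "p \<in> Q" "q \<in> Q"
    moreover have "p + q \<in> {q \<in> H. \<forall>t\<in>T. q + t \<in> T}"
      if "p \<in> {q \<in> H. \<forall>t\<in>T. q + t \<in> T}" "q \<in> {q \<in> H. \<forall>t\<in>T. q + t \<in> T}"
      using that H_add by (simp add: add.assoc)
    ultimately show "p + q \<in> Q"
      using pair[of p q] act[of p q] act[of q p] unfolding Q_def by blast
  qed
  moreover have "E \<subseteq> Q"
  proof
    fix e assume e: "e \<in> E"
    show "e \<in> Q"
    proof (cases "e \<in> H")
      case True
      then have eF: "e \<in> F" using EH e by blast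
      have "e + t \<in> T" if t: "t \<in> T" for t
      proof (rule ccontr)
        assume n: "e + t \<notin> T"
        have "t + e \<in> V - H" using add_VH TV t True by blast
        then have "t + e \<notin> E" using n unfolding T_def by (auto simp: add.commute)
        then have "e \<notin> stab t" using stabD0[of e t] t unfolding T_def by blast
        moreover obtain s where s: "s \<in> T" "s + t \<notin> F" using other by blast
        ultimately have "e \<in> stab s" using flip_01[of s t e] TV t e eF nE by blast
        then have "s + e \<in> E" using stabD0 s unfolding T_def by blast
        moreover have "s + e \<in> V - H" using add_VH TV s True by blast
        ultimately have "s + (s + e) + t \<in> T" using TTT[of s "s + e" t] s t unfolding T_def by blast
        then show False using n by simp
      qed
      then show ?thesis using True unfolding Q_def by blast
    qed (use e in \<open>auto simp: Q_def T_def\<close>)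
  qed
  moreover have "Q \<noteq> V"
  proof -
    obtain v where "v \<in> F" "x0 + v \<notin> E" using stab_neq_F proper by metis
    then have "x0 + v \<in> V - H" "x0 + v \<notin> T" using proper add_VH F_in_H T_def by blast+
    then show ?thesis unfolding Q_def by blast
  qed
  moreover have "Q \<subseteq> V" using TV H_subset unfolding Q_def by blast
  ultimately have "Q = {0}"
    using subspace_containing_E[of Q] by simp
  moreover have "x \<in> Q" using xyzT unfolding Q_def by blast
  ultimately show False using x by auto
qed

text \<open>The cone argument with \<open>b = True\<close> gives
  \<open>E \<inter> H \<subseteq> F\<close>. Outside \<open>H\<close>, \<open>E\<close> meets
  exactly two cosets of \<open>F\<close>: with only one it would lie in a proper subspace, and three
  are contradictory.\<close>

lemma PG_sum_if_adjacent_cosets_full: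
  assumes x: "x \<in> V - H" and u0: "u0 \<in> F" "u0 \<notin> E" "u0 \<notin> stab x"
    and full: "\<And>y u. \<lbrakk>y \<in> V - H; x + y \<notin> F; x + y \<in> E; u \<in> F\<rbrakk> \<Longrightarrow> y + u \<in> E"
  shows "\<exists>A B. subspace A \<and> subspace B \<and> A \<subseteq> V \<and> B \<subseteq> V \<and> A \<inter> B = {0} \<and> E = (A \<union> B) - {0}"
proof -
  have mixed: "stab x \<noteq> F" using u0 by blast
  obtain v0 v1 where v: "v0 \<in> F" "x + v0 \<notin> E" "v1 \<in> F" "x + v1 \<in> E"
    using stab_neq_F mixed by metis
  have full': "x + a + u \<in> E" if "a \<in> H" "a \<notin> F" "a \<in> E" "u \<in> F" for a u
    using full[OF add_VH[OF x], of a u] that by simp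
  have no: False if a: "a \<in> H" "a \<notin> F" "a \<in> E" for a
  proof (rule uniform_cone_cosets_empty[OF x, of True a])
    fix m a w
    assume m: "m \<in> H" "m \<notin> F" and a: "a \<in> H" "a \<notin> F" and ma: "m + a \<notin> F"
      and aE: "(a \<in> E) = True" and w: "w \<in> F" "(x + m + w \<in> E) \<noteq> (m \<in> E)"
    have maH: "m + a \<in> H" using m a H_add by blast
    have mE: "m \<notin> E" "x + m + w \<in> E" using w full'[of m w] m by auto
    have "m + a \<in> E"
    proof (rule ccontr)
      assume c: "m + a \<notin> E"
      have eq: "x + m + u1 \<in> E \<longleftrightarrow> x + m + a + u2 \<in> E" if u: "u1 \<in> F" "u2 \<in> F" for u1 u2
      proof -
        have "m + (u1 + v0) \<notin> E" "a + (u1 + u2) \<in> E" "m + a + (v0 + u2) \<notin> E" "x + a + (v0 + u1 + u2) \<in> E"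
          using F_unmixed m a maH ma c mE aE u v F_add full'[of a] by simp_all
        then show ?thesis
          using claw_pattern3[of "a + (u1 + u2)" "m + (u1 + v0)" "x + v0"] v by (simp add: char2)
      qed
      have "x + m + 0 \<in> E" "x + m + u0 \<in> E"
        using eq[of w 0] eq[of 0 0] eq[of u0 0] mE u0 w by auto
      then show False
        using flip_11[of "x + m" x u0 0] add_VH[OF x m(1)] m mE u0 x by (simp add: char2)
    qed
    then show "(m + a \<in> E) = True \<and> (\<forall>u\<in>F. (x + m + a + u \<in> E) = True)"
      using full'[of "m + a"] maH ma by (simp add: add.assoc)
  qed (use a full' in auto)
  then have EH: "e \<in> F" if "e \<in> E" "e \<in> H" for e using that by blast
  define x1 where "x1 = x + v1"
  have x1: "x1 \<in> V - H" "x1 \<in> E" "stab x1 = stab x"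
    using v add_VH[OF x F_in_H] stab_cong[of x1 x] unfolding x1_def by (auto simp: char2)
  have "\<not> E \<subseteq> cone x1"
    using subspace_containing_E subspace_cone cone_subset cone_proper cone_nontrivial x1 by metis
  then obtain y where y: "y \<in> E" "y \<notin> cone x1" by blast
  then have y': "y \<in> V - H" "x1 + y \<notin> F" using EH in_cone(2)[of x1] E_subset
    by (auto simp: cone_def add.commute)
  then have nE: "x1 + y \<notin> E" using no add_notin_H[of x1 y] x1 by blast
  define D where "D = {z. z \<in> cone x1 \<or> z + y \<in> cone x1}"
  have sD: "subspace D" unfolding D_def by (rule subspace_Un_coset[OF subspace_cone])
  show ?thesis
  proof (cases "\<exists>z\<in>E - H. x1 + z \<notin> F \<and> y + z \<notin> F")
    case True
    then obtain z where "z \<in> E - H" "x1 + z \<notin> F" "y + z \<notin> F" by blast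
    then have False
      by (intro three_coset_contradiction[of x1 y z x]) (use EH x1 y y' x mixed in auto)
    then show ?thesis ..
  next
    case False
    then have "E \<subseteq> D"
      using EH unfolding D_def cone_def by (auto simp: add.commute)
    moreover have "z \<in> V" if "z + y \<in> V" for z
      using that y' subspace_addR[OF subspace_V] by blast
    then have "D \<subseteq> V"
      using cone_subset[OF x1(1)] unfolding D_def by blast
    moreover have "x1 \<in> D" using in_cone(1)[of x1] unfolding D_def by simp
    then have "D \<noteq> {0}" using x1 by auto
    ultimately have "D = V" using subspace_containing_E[OF sD] by blast
    then have cover: "z + x1 \<in> F \<or> z + y \<in> F" if z: "z \<in> V - H" for z
    proof -
      have "z + y + x1 \<notin> F"
        using add_VH[OF x1(1) add_notin_H[of z y]] z y' F_in_H by (auto simp: add.commute)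
      then show ?thesis
        using z \<open>D = V\<close> F_in_H unfolding D_def cone_def by blast
    qed
    \<comment> \<open>If \<open>u0\<close> stabilized \<open>y + F\<close>, then \<open>y\<close>
      and \<open>y + u0\<close> would both be in \<open>E\<close>, and \<open>flip_11\<close> would
      make \<open>u0\<close> stabilize \<open>x1 + F\<close> as well.\<close>
    have "u0 \<notin> stab y"
      using two_coset_stab(2)[of y x1 u0 0] flip_11[of y x1 u0 0] stabD0[of u0 y] x1 y y' nE u0
      by (auto simp: add.commute)
    then have "stab y \<noteq> F" using u0 by blast
    then show ?thesis
      by (intro two_coset_PG_sum[of x1 y]) (use x1 y y' nE cover EH mixed in auto)
  qed
qed

text \<open>The cone argument with \<open>b = False\<close> gives
  \<open>H - F \<subseteq> E\<close>. The non-elements of \<open>F\<close> split into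
  \<open>W\<close>, along which no pair outside \<open>H\<close> avoids \<open>E\<close>, and
  members of the common stabilizer \<open>K\<close>. A triangle in the complement forces a nonzero
  non-element into \<open>K\<close>, which then yields a decomposer.\<close>

lemma no_triangle_in_complement_if_adjacent_cosets_empty:
  assumes x: "x \<in> V - H" and u0: "u0 \<in> F" "u0 \<notin> E" "u0 \<notin> stab x"
    and empty: "\<And>y u. \<lbrakk>y \<in> V - H; x + y \<notin> F; x + y \<notin> E; u \<in> F\<rbrakk> \<Longrightarrow> y + u \<notin> E"
    and pq: "p \<in> V" "q \<in> V" "p \<notin> E" "q \<notin> E" "p + q \<notin> E"
  shows "p = 0 \<or> q = 0 \<or> p = q"
proof (rule ccontr)
  assume neq: "\<not> ?thesis"
  have mixed: "stab x \<noteq> F" using u0 by blast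
  obtain v0 v1 where v: "v0 \<in> F" "x + v0 \<notin> E" "v1 \<in> F" "x + v1 \<in> E"
    using stab_neq_F mixed by metis
  have xv0: "x + v0 \<in> V - H" using add_VH x v F_in_H by blast
  have empty': "x + a + u \<notin> E" if "a \<in> H" "a \<notin> F" "a \<notin> E" "u \<in> F" for a u
    using empty[OF add_VH[OF x], of a u] that by simp
  have HF: "a \<in> E" if "a \<in> H" "a \<notin> F" for a
  proof (rule ccontr)
    assume n: "a \<notin> E"
    show False
    proof (rule uniform_cone_cosets_empty[OF x, of False a])
      fix m a w
      assume m: "m \<in> H" "m \<notin> F" and a: "a \<in> H" "a \<notin> F" and ma: "m + a \<notin> F"
        and aE: "(a \<in> E) = False" "\<And>u. u \<in> F \<Longrightarrow> (x + a + u \<in> E) = False"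
        and w: "w \<in> F" "(x + m + w \<in> E) \<noteq> (m \<in> E)"
      have maH: "m + a \<in> H" using m a H_add by blast
      have mE: "m \<in> E" "x + m + w \<notin> E" using w empty'[of m w] m by auto
      have "m + a \<notin> E"
        using claw_pattern1_cosets[of m a x v0 v1 w] m a ma aE v w mE by blast
      then show "(m + a \<in> E) = False \<and> (\<forall>u\<in>F. (x + m + a + u \<in> E) = False)"
        using empty'[of "m + a"] maH ma by (simp add: add.assoc)
    qed (use n that empty' in auto)
  qed
  have sum_E: "y + z \<in> E" if "y \<in> V - H" "z \<in> V - H" "y + z \<notin> F" for y z
    using HF add_notin_H that by blast
  \<comment> \<open>A second mixed coset is needed because \<open>flip_00\<close> compares distinct
    cosets: points of \<open>x + F\<close> itself are tested against \<open>y\<close>.\<close>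
  obtain y where y: "y \<in> V - H" "x + y \<notin> F" "stab y \<noteq> F"
  proof (rule ccontr)
    assume n: "\<not> thesis"
    have "V - cone x \<subseteq> E"
    proof
      fix z assume z: "z \<in> V - cone x"
      then have zF: "z \<notin> F" "x + z \<notin> F" by (auto simp: cone_def add.commute)
      show "z \<in> E"
      proof (cases "z \<in> H")
        case False
        then have "stab z = F" using n that z zF by blast
        then have "z + u0 \<in> E \<longleftrightarrow> z \<in> E" using u0 stab_eq_F[of z u0 0] by simp
        then show ?thesis
          using flip_00[of z x u0 0] sum_E[of z x] False z x zF u0 by (simp add: add.commute)
      qed (use HF zF in blast)
    qed
    then show False
      using subspace_containing_complement[OF subspace_cone cone_subset cone_proper] cone_nontrivial x by blast
  qed
  define W where "W = {u \<in> F. u \<notin> E \<and> u \<notin> stab x}"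
  have no00: "z \<in> E \<or> z + u \<in> E" if z: "z \<in> V - H" and u: "u \<in> W" for z u
  proof (cases "x + z \<in> F")
    case False
    then show ?thesis
      using flip_00[of z x u 0] sum_E[of z x] z x u unfolding W_def by (simp add: add.commute)
  next
    case True
    have yu: "u \<notin> stab y"
    proof
      assume "u \<in> stab y"
      moreover obtain v where "v \<in> F" "y + v \<notin> E" using stab_neq_F[OF y(3)] by metis
      ultimately show False
        using flip_00[of y x u v] stabD[of u y v] sum_E[of y x] y x u unfolding W_def
        by (simp add: add.commute)
    qed
    have "z + y \<notin> F"
    proof
      assume "z + y \<in> F"
      then have "(x + z) + (z + y) \<in> F" using True F_add by blast
      then show False using y by (simp add: char2)
    qed
    then show ?thesis
      using flip_00[of z y u 0] sum_E[of z y] z y u yu unfolding W_def by simp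
  qed
  define K where "K = {u \<in> F. \<forall>x\<in>V-H. u \<in> stab x}"
  have sK: "subspace K"
    unfolding K_def subspace_iff
    using F_add subspace_add[OF subspace_stab] subspace_0[OF subspace_stab] by auto
  have WK: "u \<in> W \<or> u \<in> K" if u: "u \<in> F" "u \<notin> E" for u
  proof (cases "u \<in> stab x")
    case True
    have "u \<in> stab z" if z: "z \<in> V - H" for z
    proof (cases "x + z \<in> F")
      case False
      have "x + v0 + u \<notin> E" using stabD[OF True v(1)] v by blast
      then show ?thesis
        using flip_00[of x z u v0] sum_E[of x z] x z u v False by blast
    qed (use stab_cong True in blast)
    then show ?thesis using u unfolding K_def by blast
  qed (use u in \<open>simp add: W_def\<close>)
  have FE: "a \<in> F" if "a \<in> H" "a \<notin> E" for a using HF that by blast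
  have "\<exists>k\<in>K. k \<notin> E \<and> k \<noteq> 0"
  proof (rule ccontr)
    assume n: "\<not> ?thesis"
    then have W: "u \<in> W" if "u \<in> H" "u \<notin> E" "u \<noteq> 0" for u
      using FE WK that by blast
    have pq0: "p + q \<noteq> 0" using neq by simp
    show False
    proof (cases "p \<in> H"; cases "q \<in> H")
      assume h: "p \<in> H" "q \<in> H"
      then have "p \<in> W" "q \<in> W" "p + q \<in> W" using W pq neq pq0 H_add by blast+
      then have "x + v0 + p \<in> E" "x + v0 + q \<in> E" "x + v0 + (p + q) \<in> E"
        using no00[OF xv0] v by blast+
      then show False
        using no_claw[of "x + v0 + p" "x + v0 + q" "x + v0 + p + q"] pq v by (simp add: char2)
    next
      assume h: "p \<in> H" "q \<notin> H"
      then show False using no00[of q p] W[of p] pq neq by (simp add: add.commute)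
    next
      assume h: "p \<notin> H" "q \<in> H"
      then show False using no00[of p q] W[of q] pq neq by simp
    next
      assume h: "p \<notin> H" "q \<notin> H"
      then show False using no00[of p "p + q"] W[of "p + q"] pq pq0 add_notin_H by simp
    qed
  qed
  then obtain k where k: "k \<in> K" "k \<notin> E" "k \<noteq> 0" by blast
  \<comment> \<open>Elements of \<open>K\<close> are restricted to those preserving
    \<open>W\<close>, which controls \<open>E\<close> inside \<open>F\<close>, where membership in
    \<open>K\<close> says nothing.\<close>
  define K' where "K' = {k \<in> K. \<forall>w\<in>W. w + k \<in> W}"
  have sK': "subspace K'"
    unfolding K'_def subspace_iff
    using subspace_0[OF sK] subspace_add[OF sK] by (auto simp flip: add.assoc)
  have KK': "k \<in> K'" if k: "k \<in> K" "k \<notin> E" for k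
  proof -
    have kx: "k \<in> stab x" "k \<in> F" using k x unfolding K_def by blast+
    have "w + k \<in> W" if w: "w \<in> W" for w
    proof -
      have wF: "w \<in> F" "w \<notin> E" "w \<notin> stab x" using w unfolding W_def by blast+
      then have "w + k \<notin> stab x" using kx subspace_addR[OF subspace_stab] by blast
      moreover have "w + k \<notin> E"
      proof
        assume "w + k \<in> E"
        moreover have "x + v0 + w \<in> E" using no00[OF xv0 w] v by blast
        moreover have "x + v0 + k \<notin> E" using stabD[OF kx(1) v(1)] v by blast
        moreover have "x + (v0 + w) + k \<in> E"
          using stabD[OF kx(1), of "v0 + w"] F_add v wF \<open>x + v0 + w \<in> E\<close> by (simp add: add.assoc)
        ultimately show False
          using no_claw[of "w + k" "x + v0 + w" "x + (v0 + w) + k"] v k wF by (simp add: char2)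
      qed
      ultimately show ?thesis using wF kx F_add unfolding W_def by blast
    qed
    then show ?thesis using k unfolding K'_def by blast
  qed
  have "K' = {0}"
  proof (rule common_stab_trivial[OF sK'])
    fix a d assume a: "a \<in> F" "a \<notin> K'" "d \<in> K'" "a \<in> E"
    show "a + d \<in> E"
    proof (rule ccontr)
      assume n: "a + d \<notin> E"
      have "a + d \<in> F" using a F_add unfolding K'_def K_def by blast
      moreover have "a + d \<notin> K'" using a subspace_addR[OF sK'] by blast
      ultimately have "a + d \<in> W" using WK KK' n by blast
      then have "a + d + d \<in> W" using a unfolding K'_def by blast
      then show False using a unfolding W_def by (simp add: add.assoc)
    qed
  qed (auto simp: K'_def K_def)
  then show False using KK' k by blast
qed

text \<open>Every \<open>u \<in> F - E\<close> now either stabilizes a coset or flips all of its points. For two mixed cosets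
  \<open>x + F\<close> and \<open>z + F\<close> joined by the complement of \<open>E\<close>, the set \<open>E \<inter> F\<close> is essentially the symmetric
  difference of the stabilizers, and their intersection stabilizes everything, hence is trivial.\<close>

lemma invariant_point:
  assumes some_not_full: "\<And>x u. \<lbrakk>x \<in> V - H; u \<in> F; u \<notin> E; u \<notin> stab x\<rbrakk> \<Longrightarrow>
      \<exists>y\<in>V - H. x + y \<notin> F \<and> x + y \<in> E \<and> (\<exists>v\<in>F. y + v \<notin> E)"
    and some_not_empty: "\<And>x u. \<lbrakk>x \<in> V - H; u \<in> F; u \<notin> E; u \<notin> stab x\<rbrakk> \<Longrightarrow>
      \<exists>y\<in>V - H. x + y \<notin> F \<and> x + y \<notin> E \<and> (\<exists>v\<in>F. y + v \<in> E)"
    and x: "x \<in> V - H" and u: "u \<in> F" "u \<notin> E" "u \<notin> stab x"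
    and a: "a \<in> H"
  shows "a + u \<in> E \<longleftrightarrow> a \<in> E"
proof -
  have not_empty: "\<exists>z\<in>V - H. x + z \<notin> F \<and> x + z \<notin> E \<and> u \<notin> stab z \<and> (\<exists>v\<in>F. z + v \<in> E)"
    if h: "x \<in> V - H" "u \<in> F" "u \<notin> E" "u \<notin> stab x" for x u
  proof -
    obtain z v where z: "z \<in> V - H" "x + z \<notin> F" "x + z \<notin> E" "v \<in> F" "z + v \<in> E"
      using some_not_empty[OF h] by blast
    have "z + v + u \<notin> E"
      using flip_11[of z x u v] z h by (simp add: add.commute)
    then have "u \<notin> stab z" using stabD[of u z v] z by blast
    then show ?thesis using z by blast
  qed
  have flip: "x + v + u \<in> E \<longleftrightarrow> x + v \<notin> E"
    if h: "x \<in> V - H" "u \<in> F" "u \<notin> E" "u \<notin> stab x" and v: "v \<in> F" for x u v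
  proof -
    obtain y v' where y: "y \<in> V - H" "x + y \<notin> F" "x + y \<in> E" "v' \<in> F" "y + v' \<notin> E"
      using some_not_full[OF h] by blast
    have "y + v' + u \<in> E"
      using flip_00[of y x u v'] y h by (simp add: add.commute)
    then have "u \<notin> stab y" using stabD[of u y v'] y by blast
    then have 1: "x + v \<in> E \<or> x + v + u \<in> E" using flip_00[of x y u v] y h v by blast
    obtain z where "z \<in> V - H" "x + z \<notin> F" "x + z \<notin> E" "u \<notin> stab z"
      using not_empty[OF h] by blast
    then have "x + v \<notin> E \<or> x + v + u \<notin> E" using flip_11[of x z u v] h v by blast
    with 1 show ?thesis by blast
  qed
  obtain z v1 where z: "z \<in> V - H" "x + z \<notin> F" "x + z \<notin> E" "u \<notin> stab z" "v1 \<in> F" "z + v1 \<in> E"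
    using not_empty[OF x u] by blast
  have zx: "z + x \<notin> F" "z + x \<notin> E" using z by (simp_all add: add.commute)
  have "stab x \<noteq> F" using u by blast
  then obtain v2 where v2: "v2 \<in> F" "x + v2 \<in> E" using stab_neq_F by metis
  have Sx: "subspace (stab x)" and Sz: "subspace (stab z)" by (rule subspace_stab)+
  have union: "e \<in> stab x \<or> e \<in> stab z" if "e \<in> F" "e \<in> E" for e
    using flip_01[of x z e] that x z by blast
  have both: "e \<in> stab x \<longleftrightarrow> e \<in> stab z" if e: "e \<in> F" "e \<notin> E" for e
    using flip_11[of x z e v2] flip_11[of z x e v1] stabD[of e x v2] stabD[of e z v1] e x z zx v2 by blast
  define L where "L = stab x \<inter> stab z"
  have sL: "subspace L" unfolding L_def using Sx Sz subspace_inter by blast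
  have LF: "L \<subseteq> F" unfolding L_def using stab_subset by blast
  have EF: "e \<in> E \<longleftrightarrow> e \<in> stab x \<or> e \<in> stab z" if "e \<in> F" "e \<notin> L" for e
    using union both that unfolding L_def by blast
  have "L = {0}"
  proof (rule common_stab_trivial[OF sL LF])
    fix y assume y: "y \<in> V - H"
    show "L \<subseteq> stab y"
    proof
      fix l assume l: "l \<in> L"
      then have lF: "l \<in> F" using LF by blast
      show "l \<in> stab y"
      proof (cases "y + x \<in> F")
        case True
        then show ?thesis using stab_cong[of y x] l unfolding L_def by blast
      next
        case False
        show ?thesis
        proof (rule ccontr)
          assume n: "l \<notin> stab y"
          obtain v where v: "v \<in> F" "y + v \<in> E" "y + v + l \<notin> E" using not_stabE[OF n lF] .
          \<comment> \<open>Both \<open>u\<close> and \<open>u + l\<close> move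
            \<open>x + F\<close>, so each constrains \<open>y + F\<close>. Together they show that
            \<open>u\<close> moves \<open>y + F\<close> but fails to flip one of its points.\<close>
          have ul: "u + l \<notin> stab x" "u + l \<notin> stab z"
            using l u z subspace_addR[OF Sx] subspace_addR[OF Sz] unfolding L_def by blast+
          have ulF: "u + l \<in> F" "v + l \<in> F" using F_add u lF v by blast+
          then have ulE: "u + l \<notin> E" using union ul by blast
          have f0: "y + v + u \<in> E \<longleftrightarrow> y + v \<notin> E" "y + (v + l) + u \<in> E \<longleftrightarrow> y + (v + l) \<notin> E"
            if "u \<notin> stab y"
            using flip[OF y u(1,2) that] v ulF by blast+
          have vl: "y + (v + l) \<notin> E" using v by (simp add: add.assoc)
          show False
          proof (cases "y + x \<in> E")
            case True
            have 1: "y + (v + l) + u \<in> E" "y + (v + l) + (u + l) \<in> E"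
              using flip_00[of y x u "v + l"] flip_00[of y x "u + l" "v + l"] y x True False u ul ulF ulE vl by blast+
            then have "u \<notin> stab y" using stabD[of u y "v + l"] ulF vl by blast
            then show False using f0 1 v by (simp add: char2)
          next
            case n: False
            have 1: "y + v + u \<notin> E" "y + v + (u + l) \<notin> E"
              using flip_11[of y x u v] flip_11[of y x "u + l" v] y x n False u ul ulF ulE v by blast+
            then have "u \<notin> stab y" using stabD[of u y v] v by blast
            then show False using f0 1 vl by (simp add: char2)
          qed
        qed
      qed
    qed
  next
    fix e d assume e: "e \<in> F" "e \<notin> L" "d \<in> L" "e \<in> E"
    then have "e + d \<in> stab x \<or> e + d \<in> stab z"
      using union[of e] subspace_add[OF Sx] subspace_add[OF Sz] unfolding L_def by blast
    moreover have "e + d \<notin> L" using e subspace_addR[OF sL] by blast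
    moreover have "e + d \<in> F" using e LF F_add by blast
    ultimately show "e + d \<in> E" using EF by blast
  qed
  \<comment> \<open>If \<open>u\<close> and \<open>e + u\<close> both flipped the coset of
    \<open>t\<close>, their sum \<open>e\<close> would stabilize it.\<close>
  have shift: "e + u \<in> stab t" if t: "t \<in> V - H" "u \<notin> stab t" "e \<notin> stab t" "e + u \<notin> E" "e \<in> F" for e t
  proof (rule ccontr)
    assume n: "e + u \<notin> stab t"
    have euF: "e + u \<in> F" using t u F_add by blast
    have "t + v + e \<in> E \<longleftrightarrow> t + v \<in> E" if v: "v \<in> F" for v
    proof -
      have "v + (e + u) \<in> F" using v euF F_add by blast
      then have "t + (v + (e + u)) + u \<in> E \<longleftrightarrow> t + (v + (e + u)) \<notin> E"
        using flip[OF t(1) u(1,2) t(2)] by blast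
      moreover have "t + v + (e + u) \<in> E \<longleftrightarrow> t + v \<notin> E"
        using flip[OF t(1) euF t(4) n v] .
      ultimately show ?thesis by (simp add: char2)
    qed
    then have "e \<in> stab t" using t unfolding stab_def by blast
    then show False using t by blast
  qed
  have EFu: "e + u \<in> E" if e: "e \<in> F" "e \<in> E" for e
  proof (rule ccontr)
    assume n: "e + u \<notin> E"
    have "e \<notin> L" using e \<open>L = {0}\<close> zero_notin_E by blast
    have "e + u \<in> stab x \<or> e + u \<in> stab z"
      using shift[of x e] shift[of z e] x z u n e \<open>e \<notin> L\<close> unfolding L_def by blast
    moreover have "e + u \<in> F" using e u F_add by blast
    ultimately have "e + u \<in> stab x" "e + u \<in> stab z" using both n by blast+
    moreover have "e \<in> stab x \<or> e \<in> stab z" using union e by blast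
    ultimately show False
      using u z subspace_addL[OF Sx] subspace_addL[OF Sz] by blast
  qed
  show ?thesis
  proof (cases "a \<in> F")
    case True
    have "a + u \<in> F" using True u F_add by blast
    then show ?thesis using EFu[of a] EFu[of "a + u"] True by (auto simp: add.assoc)
  next
    case False
    then show ?thesis using F_unmixed a u by blast
  qed
qed

end

section \<open>Translation by a single point of \<open>H\<close>\<close>

locale hyperplane_point = indecomposable_hyperplane +
  fixes w :: 'a
  assumes w_in_H: "w \<in> H" and w_neq_0: "w \<noteq> 0" and w_notin_E: "w \<notin> E"
    and add_w: "a \<in> H \<Longrightarrow> a + w \<in> E \<longleftrightarrow> a \<in> E"
begin

definition moved :: "'a set" where
  "moved = {x \<in> V - H. x + w \<in> E \<longleftrightarrow> x \<notin> E}"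

lemma movedD: "x \<in> moved \<Longrightarrow> x + w \<in> E \<longleftrightarrow> x \<notin> E"
  unfolding moved_def by blast

lemma moved_VH: "x \<in> moved \<Longrightarrow> x \<in> V - H"
  unfolding moved_def by blast

text \<open>Replaces a moved point by its translate in \<open>E\<close>. In a claw argument this
  costs nothing, since the sums that land in \<open>H\<close> do not notice
  \<open>w\<close>.\<close>

lemma moved_shift:
  assumes "x \<in> moved"
  obtains i where "i = 0 \<or> i = w" "x + i \<in> E" "x + i + w \<notin> E"
proof (cases "x \<in> E")
  case True
  then show ?thesis using that[of 0] movedD[OF assms] by simp
next
  case False
  then show ?thesis using that[of w] movedD[OF assms] by (simp add: add.assoc)
qed

text \<open>If only one of \<open>y\<close>, \<open>x + y\<close> were in \<open>E\<close>, that
  point and its translate by \<open>w\<close> would form a claw with the translate of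
  \<open>x\<close> in \<open>E\<close>.\<close>

lemma unmoved_iff:
  assumes x: "x \<in> moved" and y: "y \<in> V - H" "y \<notin> moved"
  shows "y \<in> E \<longleftrightarrow> x + y \<in> E"
proof -
  obtain i where i: "i = 0 \<or> i = w" "x + i \<in> E" "x + i + w \<notin> E" using moved_shift[OF x] .
  have yw: "y + w \<in> E \<longleftrightarrow> y \<in> E" using y unfolding moved_def by blast
  have xyw: "x + y + w \<in> E \<longleftrightarrow> x + y \<in> E" using add_w add_notin_H x y moved_VH by blast
  show ?thesis
    using no_claw[of "x + y" "x + y + w" "x + i"] no_claw[of y "y + w" "x + i"] i yw xyw w_notin_E
    by (auto simp: char2)
qed

lemma moved_nonempty: "moved \<noteq> {}"
proof
  assume e: "moved = {}"
  have "subspace {0, w}" unfolding subspace_iff by auto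
  moreover have "{0, w} \<subseteq> H" using w_in_H subspace_0[OF subspace_H] by blast
  moreover have "a + d \<in> E" if "a \<in> V" "d \<in> {0, w}" "a \<in> E" for a d
  proof -
    have "a \<notin> moved" using e by blast
    then show ?thesis using that add_w[of a] unfolding moved_def by auto
  qed
  ultimately have "{0, w} = {0}"
    using invariant_subspace_trivial[of "{0, w}"] H_subset H_neq by blast
  then show False using w_neq_0 by blast
qed

text \<open>Otherwise the span of \<open>moved\<close> would be a decomposer.\<close>

lemma subspace_containing_moved:
  assumes D: "subspace D" "D \<subseteq> V" "moved \<subseteq> D"
  shows "D = V"
proof (rule ccontr)
  assume "D \<noteq> V"
  define S where "S = span moved"
  have sS: "subspace S" unfolding S_def by (rule subspace_span)
  have mS: "moved \<subseteq> S" unfolding S_def by (rule span_superset)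
  have SD: "S \<subseteq> D" unfolding S_def by (rule span_minimal[OF D(3) D(1)])
  define Q where "Q = {d \<in> S. \<forall>a\<in>V - S. a + d \<in> E \<longleftrightarrow> a \<in> E}"
  have "subspace Q"
    unfolding subspace_iff
  proof (intro conjI ballI)
    show "0 \<in> Q" using subspace_0[OF sS] unfolding Q_def by simp
    fix d d' assume d: "d \<in> Q" "d' \<in> Q"
    have "a + (d + d') \<in> E \<longleftrightarrow> a \<in> E" if a: "a \<in> V - S" for a
    proof -
      have "d \<in> S" using d unfolding Q_def by blast
      then have "a + d \<in> V - S"
        using a SD D subspace_addR[OF sS] subspace_add[OF subspace_V] by blast
      then have "a + d + d' \<in> E \<longleftrightarrow> a + d \<in> E" using d unfolding Q_def by blast
      also have "\<dots> \<longleftrightarrow> a \<in> E" using d a unfolding Q_def by blast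
      finally show ?thesis by (simp add: add.assoc)
    qed
    then show "d + d' \<in> Q" using d subspace_add[OF sS] unfolding Q_def by blast
  qed
  moreover have "moved \<subseteq> Q"
  proof
    fix x assume x: "x \<in> moved"
    have "a + x \<in> E \<longleftrightarrow> a \<in> E" if a: "a \<in> V - S" for a
    proof (cases "a \<in> H")
      case True
      have "x + a \<notin> moved" using mS x a subspace_addL[OF sS] by blast
      then show ?thesis
        using unmoved_iff[OF x add_VH[OF moved_VH[OF x] True]] by (simp add: char2)
    next
      case False
      then have "a \<in> V - H" "a \<notin> moved" using a mS by blast+
      then show ?thesis using unmoved_iff[OF x] by (simp add: add.commute)
    qed
    then show "x \<in> Q" using x mS unfolding Q_def by blast
  qed
  ultimately have "S \<subseteq> Q" unfolding S_def using span_minimal by blast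
  have "S = {0}"
  proof (rule invariant_subspace_trivial[OF sS])
    show "S \<subseteq> V" "S \<noteq> V" using SD D \<open>D \<noteq> V\<close> by blast+
    fix a d assume "a \<in> V" "a \<notin> S" "d \<in> S" "a \<in> E"
    then show "a + d \<in> E" using \<open>S \<subseteq> Q\<close> unfolding Q_def by blast
  qed
  then have "moved \<subseteq> {0}" using mS by blast
  then show False using moved_nonempty moved_VH subspace_0[OF subspace_H] by blast
qed

text \<open>The exceptional points \<open>B\<close> and their translates \<open>C\<close> by moved
  points form a set stabilized by \<open>moved\<close>, hence by all of \<open>V\<close>. If
  nonempty, it would contain \<open>0\<close>, but \<open>0\<close> is neither outside
  \<open>H\<close> nor the sum of a moved and an unmoved point.\<close>

lemma unmoved_in_E:
  assumes y: "y \<in> V - H" "y \<notin> moved"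
  shows "y \<in> E"
proof (rule ccontr)
  assume yE: "y \<notin> E"
  define B where "B = {y \<in> V - H. y \<notin> moved \<and> y \<notin> E}"
  have step: "x + x' + b \<in> B" if x: "x \<in> moved" "x' \<in> moved" and b: "b \<in> B" for x x' b
  proof -
    define t where "t = x + x' + b"
    have tH: "t \<in> V - H"
      using add_VH[of b "x + x'"] add_notin_H[of x x'] x b moved_VH unfolding t_def B_def
      by (simp add: add.commute)
    have bE: "b \<notin> E" "b + w \<notin> E" "b \<in> V - H" "b \<notin> moved" using b unfolding B_def moved_def by blast+
    have bx: "x + b \<notin> E" "x' + b \<notin> E" using unmoved_iff x bE by blast+
    have "t \<notin> moved"
    proof
      assume t: "t \<in> moved"
      have "t + b \<notin> E" using unmoved_iff[OF t, of b] bE by blast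
      then have xx: "x + x' \<notin> E" unfolding t_def by (simp add: char2)
      have "x + b + w \<notin> E" "x' + b + w \<notin> E" "x + x' + w \<notin> E"
        using bx xx add_w add_notin_H x bE moved_VH by blast+
      moreover obtain i where "i = 0 \<or> i = w" "x + i \<in> E" using moved_shift x by metis
      moreover obtain j where "j = 0 \<or> j = w" "x' + j \<in> E" using moved_shift x by metis
      moreover obtain k where "k = 0 \<or> k = w" "t + k \<in> E" using moved_shift t by metis
      ultimately show False
        using no_claw[of "x + i" "x' + j" "t + k"] bx xx bE unfolding t_def by (auto simp: char2)
    qed
    moreover have "t \<notin> E"
      using unmoved_iff[OF x(1) tH \<open>t \<notin> moved\<close>] bx unfolding t_def by (simp add: char2)
    ultimately show ?thesis using tH unfolding B_def t_def by blast
  qed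
  define C where "C = {x + b | x b. x \<in> moved \<and> b \<in> B}"
  define Q where "Q = {q \<in> V. \<forall>b\<in>B \<union> C. q + b \<in> B \<union> C}"
  have "subspace Q"
    unfolding subspace_iff Q_def using subspace_0[OF subspace_V] subspace_add[OF subspace_V]
    by (auto simp: add.assoc)
  moreover have "moved \<subseteq> Q"
  proof
    fix x assume x: "x \<in> moved"
    have "x + b \<in> B \<union> C" if b: "b \<in> B \<union> C" for b
    proof (cases "b \<in> B")
      case False
      then obtain x' b' where "b = x' + b'" "x' \<in> moved" "b' \<in> B" using b unfolding C_def by blast
      then show ?thesis using step[of x x' b'] x by (simp add: add.assoc)
    qed (use x in \<open>auto simp: C_def\<close>)
    then show "x \<in> Q" using x moved_VH unfolding Q_def by blast
  qed
  ultimately have "Q = V" using subspace_containing_moved unfolding Q_def by blast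
  then have "y + y \<in> B \<union> C" using y yE unfolding Q_def B_def by blast
  moreover have "0 \<notin> B" using subspace_0[OF subspace_H] unfolding B_def by blast
  ultimately obtain x b where "0 = x + b" "x \<in> moved" "b \<in> B" unfolding C_def by auto
  then have "x = b" by (metis add_eq_0)
  then show False using \<open>x \<in> moved\<close> \<open>b \<in> B\<close> unfolding B_def by blast
qed

section \<open>Parity on squares outside \<open>H\<close>\<close>

lemma moved_add:
  assumes x: "x \<in> moved" and z: "z \<in> H" "z \<notin> E"
  shows "x + z \<in> moved"
proof (rule ccontr)
  assume n: "x + z \<notin> moved"
  have xz: "x + z \<in> V - H" using add_VH x z moved_VH by blast
  then have "x + z \<in> E" using unmoved_in_E n by blast
  then show False using unmoved_iff[OF x xz n] z by simp
qed

text \<open>The eight even patterns on the square are excluded by one claw each, after translating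
  some of the points by \<open>w\<close>.\<close>

lemma moved_parity_aux:
  assumes x: "x \<in> moved" "x + c \<in> moved" and z: "z \<in> H" "z \<notin> E" and c: "c \<in> E" "c + z \<notin> E"
  shows "((x \<in> E) \<noteq> (x + z \<in> E)) \<noteq> ((x + c \<in> E) \<noteq> (x + c + z \<in> E))"
proof -
  have cH: "c \<in> H" using add_notin_H[of x "x + c"] x moved_VH by force
  have m: "x + z \<in> moved" "x + c + z \<in> moved" using moved_add x z by blast+
  have f: "x + w \<in> E \<longleftrightarrow> x \<notin> E" "x + z + w \<in> E \<longleftrightarrow> x + z \<notin> E"
    "x + c + w \<in> E \<longleftrightarrow> x + c \<notin> E" "x + c + z + w \<in> E \<longleftrightarrow> x + c + z \<notin> E"
    using movedD m x by blast+
  have g: "z + w \<notin> E" "c + w \<in> E" "c + z + w \<notin> E"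
    using add_w[of z] add_w[of c] add_w[of "c + z"] z c cH H_add by blast+
  have "\<not> (x \<in> E \<and> x + z \<in> E \<and> x + c \<notin> E \<and> x + c + z \<notin> E)"
    using no_claw[of c x "x + z"] z c by (auto simp: char2)
  moreover have "\<not> (x \<notin> E \<and> x + z \<notin> E \<and> x + c \<in> E \<and> x + c + z \<in> E)"
    using no_claw[of c "x + c" "x + c + z"] z c by (auto simp: char2)
  moreover have "\<not> (x \<notin> E \<and> x + z \<notin> E \<and> x + c + w \<in> E \<and> x + c + z + w \<in> E)"
    using no_claw[of "c + w" "x + c + w" "x + c + w + z"] z c g by (auto simp: char2)
  moreover have "\<not> (x \<in> E \<and> x + z \<in> E \<and> x + c + w \<notin> E \<and> x + c + z + w \<notin> E)"
    using no_claw[of "c + w" x "x + z"] z c g by (auto simp: char2)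
  moreover have "\<not> (x \<in> E \<and> x + z + w \<in> E \<and> x + c + w \<notin> E \<and> x + c + z \<notin> E)"
    using no_claw[of "c + w" x "x + z + w"] z c g by (auto simp: char2)
  moreover have "\<not> (x + w \<in> E \<and> x + z \<in> E \<and> x + c \<notin> E \<and> x + c + z + w \<notin> E)"
    using no_claw[of "c + w" "x + w" "x + z"] z c g by (auto simp: char2)
  moreover have "\<not> (x \<in> E \<and> x + z + w \<in> E \<and> x + c \<notin> E \<and> x + c + z + w \<notin> E)"
    using no_claw[of c x "x + z + w"] z c g by (auto simp: char2)
  moreover have "\<not> (x + w \<in> E \<and> x + z \<in> E \<and> x + c + w \<notin> E \<and> x + c + z \<notin> E)"
    using no_claw[of c "x + w" "x + z"] z c g by (auto simp: char2)
  ultimately show ?thesis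
    using f by (cases "x \<in> E"; cases "x + z \<in> E"; cases "x + c \<in> E"; cases "x + c + z \<in> E") simp_all
qed

text \<open>Since \<open>z \<notin> E\<close>, this says that the plane of \<open>x\<close>,
  \<open>c\<close>, \<open>z\<close> is even.\<close>

lemma moved_parity:
  assumes x: "x \<in> moved" "x + c \<in> moved" and z: "z \<in> H" "z \<notin> E"
  shows "((x \<in> E) \<noteq> (x + z \<in> E)) = ((x + c \<in> E) \<noteq> (x + c + z \<in> E)) \<longleftrightarrow> (c \<in> E) = (c + z \<in> E)"
proof -
  have m: "x + z \<in> moved" "x + c + z \<in> moved" using moved_add x z by blast+
  have f: "x + w \<in> E \<longleftrightarrow> x \<notin> E" "x + z + w \<in> E \<longleftrightarrow> x + z \<notin> E"
    "x + c + w \<in> E \<longleftrightarrow> x + c \<notin> E" "x + c + z + w \<in> E \<longleftrightarrow> x + c + z \<notin> E"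
    using movedD m x by blast+
  consider (01) "c \<notin> E" "c + z \<in> E" | (10) "c \<in> E" "c + z \<notin> E"
    | (00) "c \<notin> E" "c + z \<notin> E" | (11) "c \<in> E" "c + z \<in> E" by blast
  then show ?thesis
  proof cases
    case 10
    then show ?thesis using moved_parity_aux[OF x z] 10 by simp
  next
    case 01
    have e: "x + (c + z) = x + c + z" "x + c + z + z = x + c" "c + z + z = c" by (simp_all add: char2)
    show ?thesis using moved_parity_aux[of x "c + z" z, unfolded e] m x z 01 by blast
  next
    case 00
    have "\<not> (x + i \<in> E \<and> x + z + i \<in> E \<and> x + c + i \<in> E \<and> x + c + z + i \<notin> E)"
      "\<not> (x + i \<in> E \<and> x + z + i \<in> E \<and> x + c + i \<notin> E \<and> x + c + z + i \<in> E)"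
      "\<not> (x + i \<in> E \<and> x + z + i \<notin> E \<and> x + c + i \<in> E \<and> x + c + z + i \<in> E)"
      "\<not> (x + i \<notin> E \<and> x + z + i \<in> E \<and> x + c + i \<in> E \<and> x + c + z + i \<in> E)" for i
      using no_claw[of "x + i" "x + z + i" "x + c + i"] no_claw[of "x + i" "x + z + i" "x + c + z + i"]
        no_claw[of "x + i" "x + c + i" "x + c + z + i"] no_claw[of "x + z + i" "x + c + i" "x + c + z + i"]
        z 00 by (auto simp: char2)
    \<comment> \<open>At \<open>i = w\<close> all four memberships are negated, so excluding three
      elements of \<open>E\<close> on the square also excludes exactly one.\<close>
    from this[of 0] this[of w] show ?thesis using f 00 by (simp only: add_0_right) argo
  next
    case 11
    have "\<not> (x + i \<in> E \<and> x + z + i \<notin> E \<and> x + c + i \<notin> E \<and> x + c + z + i \<notin> E)"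
      "\<not> (x + i \<notin> E \<and> x + z + i \<in> E \<and> x + c + i \<notin> E \<and> x + c + z + i \<notin> E)"
      "\<not> (x + i \<notin> E \<and> x + z + i \<notin> E \<and> x + c + i \<in> E \<and> x + c + z + i \<notin> E)"
      "\<not> (x + i \<notin> E \<and> x + z + i \<notin> E \<and> x + c + i \<notin> E \<and> x + c + z + i \<in> E)" for i
      using no_claw[of c "c + z" "x + i"] no_claw[of c "c + z" "x + z + i"]
        no_claw[of c "c + z" "x + c + i"] no_claw[of c "c + z" "x + c + z + i"]
        z 11 by (auto simp: char2)
    from this[of 0] this[of w] show ?thesis using f 11 by (simp only: add_0_right) argo
  qed
qed

text \<open>Since \<open>w\<close> flips every moved point, one of \<open>z\<close> and
  \<open>z + w\<close> fixes membership on all of them. It is nonzero and decomposes the whole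
  matroid.\<close>

lemma uniform_shift_contradiction:
  assumes sub: "\<And>z z'. \<lbrakk>z \<in> H; z' \<in> H; z \<notin> E; z' \<notin> E\<rbrakk> \<Longrightarrow> z + z' \<notin> E"
    and const: "\<And>x y z. \<lbrakk>x \<in> moved; y \<in> moved; z \<in> H; z \<notin> E\<rbrakk>
      \<Longrightarrow> ((x \<in> E) = (x + z \<in> E)) \<longleftrightarrow> ((y \<in> E) = (y + z \<in> E))"
    and z: "z \<in> H" "z \<notin> E" "z \<noteq> 0" "z \<noteq> w"
  shows False
proof -
  obtain x where x: "x \<in> moved" using moved_nonempty by blast
  have "\<exists>e. e \<in> H \<and> e \<notin> E \<and> e \<noteq> 0 \<and> ((x \<in> E) = (x + e \<in> E))"
  proof (cases "(x \<in> E) = (x + z \<in> E)")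
    case False
    then have "(x \<in> E) = (x + z + w \<in> E)" using movedD[OF moved_add[OF x z(1,2)]] by blast
    then show ?thesis
      using z H_add[OF z(1) w_in_H] add_w[OF z(1)] by (metis add.assoc add_eq_0)
  qed (use z in blast)
  then obtain e where e: "e \<in> H" "e \<notin> E" "e \<noteq> 0" "(x \<in> E) = (x + e \<in> E)" by blast
  have "{0, e} = {0}"
  proof (rule invariant_subspace_trivial)
    show "subspace {0, e}" unfolding subspace_iff by auto
    show "{0, e} \<subseteq> V" "{0, e} \<noteq> V"
      using e H_subset H_neq subspace_0[OF subspace_H] by blast+
    fix a d assume a: "a \<in> V" "d \<in> {0, e}" "a \<in> E"
    have "a + e \<in> E"
    proof -
      consider "a \<in> H" | "a \<in> moved" | "a \<in> V - H" "a \<notin> moved" using a by blast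
      then show ?thesis
      proof cases
        case 1
        then show ?thesis using sub[of "a + e" e] e a H_add by (auto simp: add.assoc)
      next
        case 2
        then show ?thesis using const[OF x 2 e(1,2)] e a by blast
      next
        case 3
        have "a + e \<notin> moved" using moved_add[of "a + e" e] 3 e by (auto simp: add.assoc)
        then show ?thesis using unmoved_in_E add_VH 3 e by blast
      qed
    qed
    then show "a + d \<in> E" using a by auto
  qed
  then show False using e by blast
qed

text \<open>If \<open>x + x'\<close> is outside the span \<open>S\<close> of \<open>H - E\<close>,
  then \<open>x + x'\<close> and \<open>x + x' + z\<close> are in \<open>E\<close> and
  \<open>moved_parity\<close> applies. Otherwise a moved \<open>x''\<close> outside \<open>S\<close>
  and \<open>x + S\<close> mediates. It exists because the moved points would otherwise span only
  \<open>S\<close> and \<open>x + S\<close>, forcing \<open>y\<close> into \<open>x + S\<close>, all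
  of which is moved.\<close>

lemma uniform_shift_if_unmoved:
  assumes y: "y \<in> V - H" "y \<notin> moved"
    and x: "x \<in> moved" "x' \<in> moved" and z: "z \<in> H" "z \<notin> E"
  shows "((x \<in> E) = (x + z \<in> E)) \<longleftrightarrow> ((x' \<in> E) = (x' + z \<in> E))"
proof -
  define S where "S = span {z \<in> H. z \<notin> E}"
  have sS: "subspace S" unfolding S_def by (rule subspace_span)
  have ZS: "z \<in> S" if "z \<in> H" "z \<notin> E" for z
    unfolding S_def using that by (auto intro: span_base)
  have SH: "S \<subseteq> H" unfolding S_def by (rule span_minimal[OF _ subspace_H]) blast
  define Q where "Q = {s. \<forall>x\<in>moved. x + s \<in> moved}"
  have "subspace Q" unfolding Q_def subspace_iff by (auto simp flip: add.assoc)
  moreover have "{z \<in> H. z \<notin> E} \<subseteq> Q" unfolding Q_def using moved_add by blast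
  ultimately have SQ: "S \<subseteq> Q" unfolding S_def using span_minimal by blast
  have *: "((x \<in> E) = (x + z \<in> E)) \<longleftrightarrow> ((x' \<in> E) = (x' + z \<in> E))"
    if x: "x \<in> moved" "x' \<in> moved" "x + x' \<notin> S" for x x'
  proof -
    have "x + x' + z \<notin> S" using ZS z x subspace_addR[OF sS] by blast
    moreover have "x + x' \<in> H" using add_notin_H x moved_VH by blast
    ultimately have "x + x' \<in> E" "x + x' + z \<in> E" using ZS x z H_add by blast+
    then show ?thesis using moved_parity[of x "x + x'" z] x z by (simp add: add.assoc[symmetric]) blast
  qed
  show ?thesis
  proof (cases "x + x' \<in> S")
    case True
    define C where "C = {v. v \<in> S \<or> v + x \<in> S}"
    have "\<not> moved \<subseteq> C"
    proof
      assume "moved \<subseteq> C"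
      moreover have "subspace C" unfolding C_def by (rule subspace_Un_coset[OF sS])
      moreover have "v \<in> V" if "v \<in> C" for v
      proof -
        have "v \<in> V \<or> v + x \<in> V" using that SH H_subset unfolding C_def by blast
        then show ?thesis using x moved_VH subspace_addR[OF subspace_V] by blast
      qed
      ultimately have "C = V" using subspace_containing_moved by blast
      then have "y + x \<in> S" using y SH unfolding C_def by blast
      then have "x + (y + x) \<in> moved" using SQ x unfolding Q_def by blast
      then show False using y by (simp add: char2)
    qed
    then obtain x'' where x'': "x'' \<in> moved" "x'' + x \<notin> S" unfolding C_def by blast
    have "(x'' + x) + (x + x') \<notin> S" using True x'' subspace_addR[OF sS] by blast
    then have "x'' + x' \<notin> S" by (simp add: char2)
    then show ?thesis using *[of x'' x] *[of x'' x'] x x'' by blast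
  qed (use * x in blast)
qed

definition square_odd :: "'a \<Rightarrow> 'a \<Rightarrow> 'a \<Rightarrow> bool" where
  "square_odd x c d \<longleftrightarrow> (((x \<in> E) \<noteq> (x + c \<in> E)) \<noteq> (x + d \<in> E)) \<noteq> (x + c + d \<in> E)"

definition line_odd :: "'a \<Rightarrow> 'a \<Rightarrow> bool" where
  "line_odd c d \<longleftrightarrow> ((c \<in> E) \<noteq> (d \<in> E)) \<noteq> (c + d \<in> E)"

lemma plane_even_if_square:
  assumes sq: "\<And>x c d. \<lbrakk>x \<in> V - H; c \<in> H; d \<in> H\<rbrakk> \<Longrightarrow> square_odd x c d = line_odd c d"
    and p: "p \<in> V" "q \<in> V" "r \<in> V"
  shows "\<not> plane_odd p q r"
proof -
  have even: "\<not> plane_odd c d x" if "x \<in> V - H" "c \<in> H" "d \<in> H" for x c d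
    using sq[OF that] unfolding plane_odd_def square_odd_def line_odd_def
    by (simp add: add.commute[of _ x] add.assoc) argo
  have even': "\<not> plane_odd p q r" if r: "r \<in> V - H" and p: "p \<in> V" "q \<in> V" for p q r
  proof -
    have "p + r \<in> H" if "p \<notin> H" using add_notin_H that r p by blast
    moreover have "q + r \<in> H" if "q \<notin> H" using add_notin_H that r p by blast
    moreover have "plane_odd p q r = plane_odd (p + r) q r" "plane_odd p q r = plane_odd p (q + r) r"
      "plane_odd p q r = plane_odd (p + r) (q + r) r"
      unfolding plane_odd_def by (simp_all add: char2) argo+
    ultimately show ?thesis using even r by blast
  qed
  show ?thesis
  proof (cases "p \<in> H \<and> q \<in> H \<and> r \<in> H")
    case True
    obtain x where x: "x \<in> V - H" using H_neq H_subset by blast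
    then have xr: "x + r \<in> V - H" using add_VH True by blast
    have "q + r \<in> H" using H_add True by blast
    \<comment> \<open>The three lines through \<open>p\<close> cover the plane and count
      \<open>p\<close> three times. The squares over them, two based at \<open>x\<close> and one at
      \<open>x + r\<close>, cancel point by point.\<close>
    then have "square_odd x p q = line_odd p q" "square_odd x p r = line_odd p r"
      "square_odd x p (q + r) = line_odd p (q + r)" "square_odd (x + r) p q = line_odd p q"
      using sq x xr True by blast+
    then show ?thesis
      unfolding plane_odd_def square_odd_def line_odd_def by (simp add: char2) argo
  next
    case False
    have "plane_odd p q r = plane_odd p r q" "plane_odd p q r = plane_odd r q p"
      unfolding plane_odd_def by (simp_all add: char2) argo+
    then show ?thesis using even' False p by blast
  qed
qed

text \<open>For fixed \<open>x\<close> the function \<open>g x\<close> below is additive as soon as one summand lies outside \<open>E\<close>. An odd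
  plane is a failure \<open>(c, d)\<close> of additivity in general; this failure persists when \<open>c\<close> or \<open>d\<close> is shifted
  by a sum \<open>s\<close> of two elements outside \<open>E\<close>, and comparing the shifted squares gives \<open>s \<notin> E\<close>.\<close>

lemma complement_closed_if_odd_plane:
  assumes all: "V - H \<subseteq> moved" and p: "p \<in> V" "q \<in> V" "r \<in> V" "plane_odd p q r"
    and z: "z \<in> H" "z' \<in> H" "z \<notin> E" "z' \<notin> E"
  shows "z + z' \<notin> E"
proof -
  define g where "g x c \<longleftrightarrow> ((x \<in> E) \<noteq> (x + c \<in> E)) \<noteq> (c \<in> E)" for x c
  have g0: "g x (c + z) \<longleftrightarrow> g x c \<noteq> g x z" if "x \<in> V - H" "c \<in> H" "z \<in> H" "z \<notin> E" for x c z
  proof -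
    have "x \<in> moved" "x + c \<in> moved" using all that add_VH by blast+
    from moved_parity[OF this that(3,4)] show ?thesis
      unfolding g_def using that(4) by (simp only: add.assoc) argo
  qed
  define s where "s = z + z'"
  have sH: "s \<in> H" unfolding s_def using H_add z by blast
  have gs: "g x (c + s) \<longleftrightarrow> g x c \<noteq> g x s" if "x \<in> V - H" "c \<in> H" for x c
    using g0[of x "c + z" z'] g0[of x c z] g0[of x z z'] that z H_add unfolding s_def
    by (simp add: add.assoc) argo
  obtain x c d where x: "x \<in> V - H" "c \<in> H" "d \<in> H" "square_odd x c d \<noteq> line_odd c d"
    using plane_even_if_square p by blast
  have delta: "square_odd x c d \<noteq> line_odd c d \<longleftrightarrow> g x (c + d) \<noteq> (g x c \<noteq> g x d)" for x c d
    unfolding square_odd_def line_odd_def g_def by (simp only: add.assoc) argo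
  have inE: "c \<in> E" "d \<in> E" "c + d \<in> E"
    if "x \<in> V - H" "c \<in> H" "d \<in> H" "square_odd x c d \<noteq> line_odd c d" for x c d
  proof -
    show "d \<in> E" using delta[of x c d] g0[of x c d] that by argo
    show "c \<in> E" using delta[of x c d] g0[of x d c] that by (simp only: add.commute[of d c]) argo
    show "c + d \<in> E"
      using delta[of x c d] g0[of x d "c + d"] g0[of x c "c + d"] that H_add
      by (simp add: char2) argo
  qed
  have ds: "square_odd x c (d + s) \<noteq> line_odd c (d + s)"
    using delta[of x c d] delta[of x c "d + s"] gs[of x "c + d"] gs[of x d] x H_add
    by (simp add: add.assoc) argo
  have dH: "d + s \<in> H" "x + d \<in> V - H" "c + s \<in> H" using x sH H_add add_VH by blast+
  have cs: "square_odd x (c + s) d \<noteq> line_odd (c + s) d"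
  proof -
    have e: "c + s + d = c + d + s" by (simp add: char2)
    show ?thesis
      using delta[of x c d] delta[of x "c + s" d] gs[of x "c + d"] gs[of x c] x H_add
      unfolding e by blast
  qed
  have "square_odd (x + d) c s = line_odd c s"
    using delta[of "x + d" c s] gs[of "x + d" c] dH x by blast
  moreover have "c \<in> E" "d \<in> E" "c + d \<in> E" "d + s \<in> E" "c + (d + s) \<in> E" "c + s \<in> E"
    using inE[OF x] inE[OF x(1,2) dH(1) ds] inE[OF x(1) dH(3) x(3) cs] by blast+
  ultimately have "s \<notin> E"
    using x ds unfolding square_odd_def line_odd_def by (simp add: char2) argo
  then show ?thesis unfolding s_def .
qed

text \<open>Without a further \<open>z\<close> in \<open>H - E\<close>, translation by
  \<open>w\<close> would send some point of the triangle into \<open>E\<close>. With such a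
  \<open>z\<close>, \<open>uniform_shift_contradiction\<close> needs closure of \<open>H - E\<close>
  and uniform action. The odd plane gives closure if every point outside \<open>H\<close> is moved,
  an unmoved point gives uniformity otherwise, and \<open>moved_parity\<close> converts each into
  the other.\<close>

lemma even_planes_or_no_triangle_in_complement:
  assumes "p \<in> V" "q \<in> V" "p \<notin> E" "q \<notin> E" "p + q \<notin> E" "p \<noteq> 0" "q \<noteq> 0" "p \<noteq> q"
    and "a \<in> V" "b \<in> V" "c \<in> V"
  shows "\<not> plane_odd a b c"
proof
  assume odd: "plane_odd a b c"
  have "\<exists>z\<in>H. z \<notin> E \<and> z \<noteq> 0 \<and> z \<noteq> w"
  proof (rule ccontr)
    assume "\<not> ?thesis"
    then have w: "z = w" if "z \<in> H" "z \<notin> E" "z \<noteq> 0" for z using that by blast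
    have X: "y + w \<in> E" if "y \<in> V" "y \<notin> H" "y \<notin> E" for y
      using unmoved_in_E[of y] movedD[of y] that by blast
    have pq: "p + q \<noteq> 0" using assms by simp
    show False
    proof (cases "p \<in> H"; cases "q \<in> H")
      assume "p \<in> H" "q \<in> H"
      then show False using w[of p] w[of q] assms by auto
    next
      assume "p \<in> H" "q \<notin> H"
      then show False using w[of p] X[of q] assms by (auto simp: add.commute)
    next
      assume "p \<notin> H" "q \<in> H"
      then show False using w[of q] X[of p] assms by auto
    next
      assume "p \<notin> H" "q \<notin> H"
      then have "p + q = w" using w[of "p + q"] add_notin_H assms pq by blast
      moreover have "p + (p + q) = q" by simp
      ultimately show False using X[of p] \<open>p \<notin> H\<close> assms by metis
    qed
  qed
  then obtain z where z: "z \<in> H" "z \<notin> E" "z \<noteq> 0" "z \<noteq> w" by blast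
  show False
  proof (cases "V - H \<subseteq> moved")
    case True
    have sub: "z + z' \<notin> E" if "z \<in> H" "z' \<in> H" "z \<notin> E" "z' \<notin> E" for z z'
      using complement_closed_if_odd_plane[OF True _ _ _ odd] that assms by blast
    show False
    proof (rule uniform_shift_contradiction[OF sub _ z])
      fix x y z assume x: "x \<in> moved" "y \<in> moved" "z \<in> H" "z \<notin> E"
      then have H: "x + y \<in> H" using add_notin_H moved_VH by blast
      have "(x + y \<in> E) = (x + y + z \<in> E)"
        using sub[of "x + y" z] sub[of "x + y + z" z] H H_add[OF H x(3)] x by (auto simp: add.assoc)
      then show "((x \<in> E) = (x + z \<in> E)) \<longleftrightarrow> ((y \<in> E) = (y + z \<in> E))"
        using moved_parity[of x "x + y" z] x by simp blast
    qed
  next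
    case False
    then obtain y where y: "y \<in> V - H" "y \<notin> moved" by blast
    note const = uniform_shift_if_unmoved[OF y]
    show False
    proof (rule uniform_shift_contradiction[OF _ const z])
      fix z z' assume h: "z \<in> H" "z' \<in> H" "z \<notin> E" "z' \<notin> E"
      obtain x where x: "x \<in> moved" using moved_nonempty by blast
      have "x + z \<in> moved" using moved_add x h by blast
      then show "z + z' \<notin> E"
        using moved_parity[of x z z'] const[of x "x + z" z'] x h by blast
    qed
  qed
qed

end

section \<open>Combination of the cases\<close>

context hyperplane_decomposer
begin

text \<open>Fix a coset of \<open>F\<close> outside \<open>H\<close> and a non-element \<open>u\<close> of \<open>E\<close> in \<open>F\<close> that does not stabilize it. If
  all adjacent cosets joined to it by \<open>E\<close> are full, \<open>M\<close> is a PG-sum; if all those joined to it by the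
  complement are empty, \<open>M\<^sup>c\<close> is triangle-free. Otherwise \<open>F\<close> can be replaced by the single point \<open>u\<close>.\<close>

lemma trichotomy:
  "(\<forall>a\<in>V. \<forall>b\<in>V. \<forall>c\<in>V. \<not> plane_odd a b c)
    \<or> (\<exists>A B. subspace A \<and> subspace B \<and> A \<subseteq> V \<and> B \<subseteq> V \<and> A \<inter> B = {0} \<and> E = (A \<union> B) - {0})
    \<or> (\<forall>p\<in>V. \<forall>q\<in>V. p \<notin> E \<longrightarrow> q \<notin> E \<longrightarrow> p + q \<notin> E \<longrightarrow> p = 0 \<or> q = 0 \<or> p = q)"
    (is "?even \<or> ?PG \<or> ?tf")
proof (cases "\<exists>x u. x \<in> V - H \<and> u \<in> F \<and> u \<notin> E \<and> u \<notin> stab x")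
  case False
  then have ?tf using no_triangle_in_complement_if_stab by blast
  then show ?thesis by blast
next
  case True
  then obtain x0 u0 where x0: "x0 \<in> V - H" "u0 \<in> F" "u0 \<notin> E" "u0 \<notin> stab x0" by blast
  show ?thesis
  proof (cases "?PG \<or> ?tf")
    case nt: False
    have a: "\<exists>y\<in>V - H. x + y \<notin> F \<and> x + y \<in> E \<and> (\<exists>v\<in>F. y + v \<notin> E)"
      if "x \<in> V - H" "u \<in> F" "u \<notin> E" "u \<notin> stab x" for x u
      using PG_sum_if_adjacent_cosets_full[OF that] nt by blast
    have b: "\<exists>y\<in>V - H. x + y \<notin> F \<and> x + y \<notin> E \<and> (\<exists>v\<in>F. y + v \<in> E)"
      if "x \<in> V - H" "u \<in> F" "u \<notin> E" "u \<notin> stab x" for x u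
      using no_triangle_in_complement_if_adjacent_cosets_empty[OF that] nt by blast
    have inv: "a + u0 \<in> E \<longleftrightarrow> a \<in> E" if "a \<in> H" for a
      by (rule invariant_point[OF a b x0 that])
    have "u0 \<noteq> 0" using x0 subspace_0[OF subspace_stab] by blast
    then interpret point: hyperplane_point scale V E H u0
      using inv x0 F_in_H by unfold_locales auto
    from nt obtain p q where "p \<in> V" "q \<in> V" "p \<notin> E" "q \<notin> E" "p + q \<notin> E" "p \<noteq> 0" "q \<noteq> 0" "p \<noteq> q"
      by blast
    then have ?even using point.even_planes_or_no_triangle_in_complement by blast
    then show ?thesis by blast
  qed blast
qed

end

section \<open>Translation between flats and subspaces\<close>

context binary_space
begin

lemma diff_eq_add: "x - y = x + (y::'a)"
  by (metis add_diff_cancel_right' add.assoc add.right_neutral add_self)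

lemma span_insert_bit: "span (insert a S) = {v. v \<in> span S \<or> v + a \<in> span S}"
proof -
  have "(\<exists>k. v - scale k a \<in> span S) \<longleftrightarrow> v \<in> span S \<or> v + a \<in> span S" for v
  proof
    assume "\<exists>k. v - scale k a \<in> span S"
    then obtain k where "v - scale k a \<in> span S" by blast
    then show "v \<in> span S \<or> v + a \<in> span S" by (cases k) (simp_all add: diff_eq_add)
  next
    assume "v \<in> span S \<or> v + a \<in> span S"
    then have "v - scale 0 a \<in> span S \<or> v - scale 1 a \<in> span S" by (simp add: diff_eq_add)
    then show "\<exists>k. v - scale k a \<in> span S" by blast
  qed
  then show ?thesis unfolding span_insert by blast
qed

lemma span_pair: "span {a, b} = {0, a, b, a + b}"
  by (auto simp: span_insert_bit add_eq_swap add.commute)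

lemma span_triple: "span {a, b, c} = {0, a, b, a + b, c, a + c, b + c, a + b + c}"
  by (auto simp: span_insert_bit add_eq_swap char2)

lemma independent_pair:
  "independent {a, b} \<Longrightarrow> a \<noteq> b \<Longrightarrow> a \<noteq> 0 \<and> b \<noteq> 0 \<and> a + b \<noteq> 0"
  using dependent_zero[of "{a, b}"] by auto

lemma independent_triple_iff:
  assumes "a \<noteq> b" "a \<noteq> c" "b \<noteq> c"
  shows "independent {a, b, c} \<longleftrightarrow> a \<noteq> 0 \<and> b \<noteq> 0 \<and> c \<noteq> 0 \<and> a + b \<noteq> c"
  using assms by (auto simp: independent_insert span_insert_bit add_eq_swap add.commute)

lemma no_decomposer_imp_trivial:
  assumes M: "is_matroid (E, G)" and no: "\<nexists>F. decomposer (E, G) F"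
    and D: "subspace D" "D \<subseteq> insert 0 G" "D \<noteq> insert 0 G"
    and inv: "\<And>a d. \<lbrakk>a \<in> insert 0 G; a \<notin> D; d \<in> D; a \<in> E\<rbrakk> \<Longrightarrow> a + d \<in> E"
  shows "D = {0}"
proof (rule ccontr)
  assume n: "D \<noteq> {0}"
  have D0: "insert 0 (D - {0}) = D" using subspace_0[OF D(1)] by blast
  have G: "0 \<notin> G" "subspace (insert 0 G)" "E \<subseteq> G" using M unfolding is_matroid_def by auto
  have "\<not> mixed (E, G) A" if "coset G (D - {0}) A" for A
  proof
    assume mix: "mixed (E, G) A"
    obtain x where "x \<in> G - (D - {0})" "A = (+) x ` insert 0 (D - {0})"
      using \<open>coset G (D - {0}) A\<close> unfolding coset_def by blast
    with D0 G have x: "x \<in> G" "x \<notin> D" "A = (+) x ` D" by auto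
    obtain d d' where d: "d \<in> D" "d' \<in> D" "x + d \<in> E" "x + d' \<notin> E"
      using mix x unfolding mixed_def by auto
    have "x + d \<notin> D" "d + d' \<in> D" "x + d \<in> insert 0 G"
      using x d D G subspace_addR subspace_add by blast+
    then have "x + d + (d + d') \<in> E" using inv d by blast
    then show False using d by (simp add: char2)
  qed
  then have "decomposer (E, G) (D - {0})"
    using D D0 G n subspace_0[OF D(1)] unfolding decomposer_def flat_def by auto
  then show False using no by blast
qed

lemma claw_free_imp:
  assumes M: "is_matroid (E, G)" and cf: "claw_free (E, G)"
    and E: "x \<in> E" "y \<in> E" "z \<in> E" "x \<noteq> y" "x \<noteq> z" "y \<noteq> z"
    and nE: "x + y \<notin> E" "x + z \<notin> E" "y + z \<notin> E"
  shows "x + y + z \<in> E"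
proof (rule ccontr)
  assume n: "x + y + z \<notin> E"
  have G: "0 \<notin> G" "subspace (insert 0 G)" "E \<subseteq> G" using M unfolding is_matroid_def by auto
  have ind: "independent {x, y, z}"
    using E nE G by (subst independent_triple_iff) auto
  define F where "F = span {x, y, z} - {0}"
  have F0: "insert 0 F = span {x, y, z}" unfolding F_def using span_zero by blast
  have "span {x, y, z} \<subseteq> insert 0 G"
    by (rule span_minimal[OF _ G(2)]) (use E G in auto)
  then have flat: "flat G F" using F0 unfolding flat_def F_def by auto
  have EF: "E \<inter> F = {x, y, z}"
    using E nE n G unfolding F_def span_triple by auto
  have "dim (insert 0 F) = 3"
    unfolding F0 using dim_eq_card_independent[OF ind] E by (simp add: dim_span)
  moreover have "subspace (insert 0 F)" unfolding F0 by (rule subspace_span)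
  moreover have "\<exists>B. finite B \<and> span B = insert 0 F"
    using F0 by (intro exI[of _ "{x, y, z}"]) simp
  moreover have "0 \<notin> F" unfolding F_def by blast
  ultimately have "claw (restr (E, G) F)"
    unfolding claw_def restr_def is_matroid_def fst_conv snd_conv EF using ind F0 EF by blast
  moreover have "isomorphic N N" for N :: "'a matroid"
    unfolding isomorphic_def by (rule exI[of _ id]) simp
  ultimately have "\<exists>F N. flat (snd (E, G)) F \<and> claw N \<and> isomorphic (restr (E, G) F) N"
    using flat by (intro exI[of _ F] exI[of _ "restr (E, G) F"]) simp
  then show False using cf unfolding claw_free_def by contradiction
qed

text \<open>Otherwise a basis of \<open>H\<close> extended by \<open>x\<close> and \<open>y\<close>
  would be independent and larger than the dimension of the whole space.\<close>

lemma hyperplane_add_notin: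
  assumes M: "is_matroid (E, G)" and H: "hyperplane G H"
    and x: "x \<in> insert 0 G" "y \<in> insert 0 G" "x \<notin> insert 0 H" "y \<notin> insert 0 H"
  shows "x + y \<in> insert 0 H"
proof (rule ccontr)
  assume n: "x + y \<notin> insert 0 H"
  obtain S where S: "finite S" "span S = insert 0 G" using M unfolding is_matroid_def by auto
  have sub: "subspace (insert 0 H)" "insert 0 H \<subseteq> insert 0 G"
    and dim: "dim (insert 0 H) + 1 = dim (insert 0 G)"
    using H unfolding hyperplane_def flat_def by auto
  obtain B where B: "B \<subseteq> insert 0 H" "independent B" "insert 0 H \<subseteq> span B" "card B = dim (insert 0 H)"
    using basis_exists by blast
  obtain C where C: "C \<subseteq> insert 0 G" "independent C" "insert 0 G \<subseteq> span C" "card C = dim (insert 0 G)"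
    using basis_exists by blast
  have "B \<subseteq> span S" "C \<subseteq> span S" using B(1) C(1) sub S(2) by blast+
  then have fin: "finite C" "finite B"
    using independent_span_bound[OF S(1)] B(2) C(2) by blast+
  have sB: "span B = insert 0 H" using B span_minimal[OF B(1) sub(1)] by blast
  have "y \<notin> span (insert x B)" unfolding span_insert_bit sB using x n by (auto simp: add.commute)
  moreover have "x \<notin> span B" using sB x by simp
  ultimately have ind: "independent (insert y (insert x B))" and "y \<notin> insert x B" "x \<notin> B"
    using B(2) span_base[of y "insert x B"] span_base[of x B] by (auto simp: independent_insert)
  then have "card (insert y (insert x B)) = dim (insert 0 G) + 1"
    using fin B dim by simp
  moreover have "insert y (insert x B) \<subseteq> span C" using x B sub C by blast
  ultimately show False
    using independent_span_bound[OF fin(1) ind] C by simp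
qed

lemma plane_list:
  assumes "plane G P" "0 \<notin> G"
  obtains a b c where "P = {a, b, a + b, c, a + c, b + c, a + b + c}" "independent {a, b, c}"
    "a \<noteq> b" "a \<noteq> c" "b \<noteq> c"
proof -
  have P: "subspace (insert 0 P)" "dim (insert 0 P) = 3" "0 \<notin> P"
    using assms unfolding plane_def flat_def by auto
  obtain B where B: "B \<subseteq> insert 0 P" "independent B" "insert 0 P \<subseteq> span B" "card B = dim (insert 0 P)"
    using basis_exists by blast
  obtain a b c where abc: "B = {a, b, c}" "a \<noteq> b" "a \<noteq> c" "b \<noteq> c"
    using B P by (auto simp: card_3_iff)
  have "insert 0 P = span {a, b, c}" using B abc span_minimal[OF B(1) P(1)] by blast
  moreover have nz: "a \<noteq> 0" "b \<noteq> 0" "c \<noteq> 0" "a + b \<noteq> c"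
    using independent_triple_iff[of a b c] B abc by auto
  have "0 \<notin> {a, b, a + b, c, a + c, b + c, a + b + c}"
    using nz abc by (auto simp: add_eq_swap)
  ultimately have "P = {a, b, a + b, c, a + c, b + c, a + b + c}"
    using P unfolding span_triple by (metis insert_ident)
  then show ?thesis using that abc B by blast
qed

lemma triangle_list:
  assumes "triangle G T" "0 \<notin> G"
  obtains a b where "T = {a, b, a + b}" "a \<noteq> 0" "b \<noteq> 0" "a \<noteq> b"
proof -
  have T: "subspace (insert 0 T)" "dim (insert 0 T) = 2" "0 \<notin> T"
    using assms unfolding triangle_def flat_def by auto
  obtain B where B: "B \<subseteq> insert 0 T" "independent B" "insert 0 T \<subseteq> span B" "card B = dim (insert 0 T)"
    using basis_exists by blast
  obtain a b where ab: "B = {a, b}" "a \<noteq> b"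
    using B T by (auto simp: card_2_iff)
  have "insert 0 T = span {a, b}" using B ab span_minimal[OF B(1) T(1)] by blast
  moreover have nz: "a \<noteq> 0" "b \<noteq> 0"
    using independent_pair[of a b] B ab by auto
  have "0 \<notin> {a, b, a + b}" using nz ab by (metis add_eq_0 empty_iff insert_iff)
  ultimately have "T = {a, b, a + b}"
    using T unfolding span_pair by (metis insert_ident)
  then show ?thesis using that ab nz by blast
qed

lemma hyperplane_decomposerI:
  assumes M: "is_matroid (E, G)" and cf: "claw_free (E, G)" and H: "hyperplane G H"
    and F: "decomposer (restr (E, G) H) F" and no: "\<nexists>F. decomposer (E, G) F"
  shows "hyperplane_decomposer scale (insert 0 G) E (insert 0 H) (insert 0 F)"
proof
  have G: "0 \<notin> G" "subspace (insert 0 G)" "E \<subseteq> G" using M unfolding is_matroid_def by auto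
  have Hs: "H \<subseteq> G" "subspace (insert 0 H)" "dim (insert 0 H) + 1 = dim (insert 0 G)"
    using H unfolding hyperplane_def flat_def by auto
  have Fs: "F \<subseteq> H" "subspace (insert 0 F)" "F \<noteq> {}" "F \<noteq> H"
    and unmixed: "\<And>A. coset H F A \<Longrightarrow> \<not> mixed (E \<inter> H, H) A"
    using F unfolding decomposer_def restr_def flat_def by auto
  show "subspace (insert 0 G)" "E \<subseteq> insert 0 G" "0 \<notin> E" using G by auto
  show "x + y + z \<in> E" if "x \<in> E" "y \<in> E" "z \<in> E" "x \<noteq> y" "x \<noteq> z" "y \<noteq> z"
    "x + y \<notin> E" "x + z \<notin> E" "y + z \<notin> E" for x y z
    using claw_free_imp[OF M cf that] .
  show "D = {0}" if "subspace D" "D \<subseteq> insert 0 G" "D \<noteq> insert 0 G"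
    "\<And>a d. \<lbrakk>a \<in> insert 0 G; a \<notin> D; d \<in> D; a \<in> E\<rbrakk> \<Longrightarrow> a + d \<in> E" for D
    using no_decomposer_imp_trivial[OF M no that] .
  show "subspace (insert 0 H)" "insert 0 H \<subseteq> insert 0 G" using Hs by auto
  show "insert 0 H \<noteq> insert 0 G" using Hs by auto
  show "x + y \<in> insert 0 H" if "x \<in> insert 0 G" "y \<in> insert 0 G" "x \<notin> insert 0 H" "y \<notin> insert 0 H" for x y
    using hyperplane_add_notin[OF M H that] .
  show "subspace (insert 0 F)" "insert 0 F \<subseteq> insert 0 H" using Fs by auto
  have "0 \<notin> H" "0 \<notin> F" using Fs(1) Hs(1) G(1) by blast+
  then show "insert 0 F \<noteq> insert 0 H" "insert 0 F \<noteq> {0}"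
    using Fs(3,4) by (simp add: insert_ident, auto)
  show "a + u \<in> E \<longleftrightarrow> a \<in> E" if a: "a \<in> insert 0 H" "a \<notin> insert 0 F" "u \<in> insert 0 F" for a u
  proof -
    have aH: "a \<in> H" using a by blast
    have "a + u \<in> insert 0 H" using a Fs Hs subspace_add by blast
    moreover have "a + u \<noteq> 0" using a by (metis add_eq_0)
    ultimately have auH: "a + u \<in> H" by blast
    have "coset H F ((+) a ` insert 0 F)" using a aH unfolding coset_def by blast
    then have nm: "\<not> mixed (E \<inter> H, H) ((+) a ` insert 0 F)" by (rule unmixed)
    have "a + 0 \<in> (+) a ` insert 0 F" "a + u \<in> (+) a ` insert 0 F" using a by blast+
    then have "a \<in> (+) a ` insert 0 F" "a + u \<in> (+) a ` insert 0 F" by simp_all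
    then show ?thesis using nm aH auH unfolding mixed_def fst_conv snd_conv by blast
  qed
qed

end

theorem theorem5p1:
  fixes scale :: "bit \<Rightarrow> 'a::ab_group_add \<Rightarrow> 'a"
    and E G H :: "'a set"
  assumes "binary_space scale"
    and "binary_space.is_matroid scale (E, G)"
    and "binary_space.claw_free scale (E, G)"
    and "binary_space.hyperplane scale G H"
    and "\<exists>F. binary_space.decomposer scale (restr (E, G) H) F"
  shows "binary_space.even_plane scale (E, G)
       \<or> binary_space.PG_sum scale (E, G)
       \<or> binary_space.triangle_free scale (compl (E, G))
       \<or> (\<exists>F. binary_space.decomposer scale (E, G) F)"
proof (cases "\<exists>F. binary_space.decomposer scale (E, G) F")
  case False
  interpret binary_space scale by fact
  obtain F where F: "decomposer (restr (E, G) H) F" using assms by blast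
  interpret M: hyperplane_decomposer scale "insert 0 G" E "insert 0 H" "insert 0 F"
    by (rule hyperplane_decomposerI[OF assms(2-4) F False])
  have G: "0 \<notin> G" "E \<subseteq> G" using assms(2) unfolding is_matroid_def by auto
  consider (even) "\<forall>a\<in>insert 0 G. \<forall>b\<in>insert 0 G. \<forall>c\<in>insert 0 G. \<not> M.plane_odd a b c"
    | (PG) "\<exists>A B. subspace A \<and> subspace B \<and> A \<subseteq> insert 0 G \<and> B \<subseteq> insert 0 G \<and> A \<inter> B = {0}
        \<and> E = (A \<union> B) - {0}"
    | (tf) "\<forall>p\<in>insert 0 G. \<forall>q\<in>insert 0 G. p \<notin> E \<longrightarrow> q \<notin> E \<longrightarrow> p + q \<notin> E \<longrightarrow> p = 0 \<or> q = 0 \<or> p = q"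
    using M.trichotomy by blast
  then show ?thesis
  proof cases
    case even
    have "even_plane (E, G)"
      unfolding even_plane_def fst_conv snd_conv
    proof (intro allI impI)
      fix P assume P: "plane G P"
      then obtain a b c where abc: "P = {a, b, a + b, c, a + c, b + c, a + b + c}" "independent {a, b, c}"
        "a \<noteq> b" "a \<noteq> c" "b \<noteq> c"
        using plane_list G by metis
      have nz: "a \<noteq> 0" "b \<noteq> 0" "c \<noteq> 0" "a + b \<noteq> c"
        using independent_triple_iff[of a b c] abc by auto
      have "{a, b, c} \<subseteq> G" using P abc unfolding plane_def flat_def by blast
      then have "\<not> M.plane_odd a b c" using even by blast
      moreover have "distinct [a, b, a + b, c, a + c, b + c, a + b + c]"
        using nz abc by (auto simp: add_eq_swap)
      \<comment> \<open>Removing the seven distinct points one at a time turns the parity of the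
        cardinality into the exclusive or of \<open>plane_odd\<close>.\<close>
      moreover have "even (card (E \<inter> insert x A)) \<longleftrightarrow> (x \<in> E) \<noteq> even (card (E \<inter> A))"
        if "finite A" "x \<notin> A" for x A
        using that by (simp add: Int_insert_right)
      ultimately show "even (card (E \<inter> P))"
        unfolding abc(1) M.plane_odd_def by (simp, argo)
    qed
    then show ?thesis by blast
  next
    case PG
    then obtain A B where AB: "subspace A" "subspace B" "A \<subseteq> insert 0 G" "B \<subseteq> insert 0 G"
      "A \<inter> B = {0}" "E = (A \<union> B) - {0}" by blast
    have "insert 0 (A - {0}) = A" "insert 0 (B - {0}) = B" using AB by blast+
    then have "flat G (A - {0})" "flat G (B - {0})" using AB unfolding flat_def by auto
    moreover have "(A - {0}) \<inter> (B - {0}) = {}" "E = (A - {0}) \<union> (B - {0})" using AB by blast+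
    ultimately have "PG_sum (E, G)" unfolding PG_sum_def fst_conv snd_conv by blast
    then show ?thesis by blast
  next
    case tf
    have "\<not> (triangle G T \<and> T \<subseteq> G - E)" for T
    proof
      assume T: "triangle G T \<and> T \<subseteq> G - E"
      then obtain a b where ab: "T = {a, b, a + b}" "a \<noteq> 0" "b \<noteq> 0" "a \<noteq> b"
        using triangle_list G by metis
      then have "a \<in> G" "b \<in> G" "a \<notin> E" "b \<notin> E" "a + b \<notin> E" using T by blast+
      then show False using tf ab by blast
    qed
    then have "triangle_free (compl (E, G))"
      unfolding triangle_free_def compl_def fst_conv snd_conv by blast
    then show ?thesis by blast
  qed
qed blast

end
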